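(* Let $\{\mathcal{T}(t)\}_{t\ge 0}$ be the symmetric telegraph process with speed $c>0$ and rate $\lambda>0$, and let $t>0$. For every integer $k\ge 0$ and $0<\beta<ct$, $$P\Bigl\{ \max_{0\le s\le t} \mathcal{T}(s) \in d\beta \,\Big|\, V(0) = c,\ N(t) = 2k+1\Bigr\} = 2\,\frac{(2k+1)!}{k!^2}\, \frac{(c^2t^2 - \beta^2)^k}{(2ct)^{2k+1}}\,d\beta .$$
   Context: Let $c>0$, $\lambda>0$. Let $V(0)$ be a random variable with $P\{V(0)=c\}=P\{V(0)=-c\}=\tfrac12$ and let $\{N(t)\}_{t\ge0}$ be a homogeneous Poisson process with rate $\lambda$, independent of $V(0)$. The symmetric telegraph process is $\mathcal{T}(t)=\int_0^t V(0)(-1)^{N(s)}\,ds$, $t\ge 0$ (so $\mathcal{T}(0)=0$). A formula $P\{X\in d\beta\mid A\}=f(\beta)\,d\beta$ for $0<\beta<ct$ means that the conditional law of $X$ given the event $A$, restricted to the open interval $(0,ct)$, is absolutely continuous with density $f$. *)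

theory Defs
  imports "HOL-Probability.Probability"
begin

text \<open>
  Homogeneous Poisson process, indexed by the real times \<open>t \<ge> 0\<close> (values at negative times are
  unconstrained). As usual for a counting process, the path properties are required of every
  sample path. The truncated difference on \<^typ>\<open>nat\<close> is the genuine increment, since paths are
  nondecreasing.
\<close>

locale poisson_process = prob_space M for M :: "'a measure" +
  fixes rate :: real and N :: "real \<Rightarrow> 'a \<Rightarrow> nat"
  assumes rate_pos: "rate > 0"
    and count_measurable: "\<And>t. 0 \<le> t \<Longrightarrow> N t \<in> measurable M (count_space UNIV)"
    and count_zero: "\<And>\<omega>. \<omega> \<in> space M \<Longrightarrow> N 0 \<omega> = 0"
    and count_mono: "\<And>\<omega>. \<omega> \<in> space M \<Longrightarrow> mono_on {0..} (\<lambda>t. N t \<omega>)"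
    and count_right_continuous:
      "\<And>\<omega> t. \<omega> \<in> space M \<Longrightarrow> 0 \<le> t \<Longrightarrow> continuous (at_right t) (\<lambda>s. N s \<omega>)"
    and independent_increments:
      "\<And>n \<tau>. 0 \<le> \<tau> 0 \<Longrightarrow> (\<And>i. i < n \<Longrightarrow> \<tau> i < \<tau> (Suc i)) \<Longrightarrow>
        indep_vars (\<lambda>_. count_space UNIV) (\<lambda>i \<omega>. N (\<tau> (Suc i)) \<omega> - N (\<tau> i) \<omega>) {..<n::nat}"
    and poisson_increments:
      "\<And>s t. 0 \<le> s \<Longrightarrow> s < t \<Longrightarrow>
        distr M (count_space UNIV) (\<lambda>\<omega>. N t \<omega> - N s \<omega>) = measure_pmf (poisson_pmf (rate * (t - s)))"

definition telegraph :: "('a \<Rightarrow> real) \<Rightarrow> (real \<Rightarrow> 'a \<Rightarrow> nat) \<Rightarrow> real \<Rightarrow> 'a \<Rightarrow> real" where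
  "telegraph V0 N t \<omega> = (LBINT s:{0..t}. V0 \<omega> * (-1) ^ N s \<omega>)"

text \<open>
  The supremum is a maximum for the telegraph process; see \<open>running_max_attained\<close> below.
\<close>

definition running_max :: "(real \<Rightarrow> 'a \<Rightarrow> real) \<Rightarrow> real \<Rightarrow> 'a \<Rightarrow> real" where
  "running_max X t \<omega> = (SUP s\<in>{0..t}. X s \<omega>)"

text \<open>
  Independence of \<open>V0\<close> from the whole process \<open>N\<close>: the latter is regarded as a random element of
  the space of all functions on \<open>{0..}\<close> with the product sigma-algebra. (The library's
  \<open>indep_var\<close> would need \<open>V0\<close> and \<open>N\<close> to take values in the same type.)
\<close>

locale symmetric_telegraph = poisson_process M rate N
  for M :: "'a measure" and rate :: real and N :: "real \<Rightarrow> 'a \<Rightarrow> nat" +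
  fixes c :: real and V0 :: "'a \<Rightarrow> real"
  assumes speed_pos: "c > 0"
    and V0_measurable: "V0 \<in> borel_measurable M"
    and V0_pos: "prob {\<omega> \<in> space M. V0 \<omega> = c} = 1 / 2"
    and V0_neg: "prob {\<omega> \<in> space M. V0 \<omega> = - c} = 1 / 2"
    and V0_indep:
      "indep_set (sets (vimage_algebra (space M) V0 borel))
        (sets (vimage_algebra (space M) (\<lambda>\<omega>. \<lambda>t\<in>{0..}. N t \<omega>) (\<Pi>\<^sub>M t\<in>{0..}. count_space UNIV)))"

text \<open>
  \<open>P{X \<in> dx | A} = f x dx\<close> for \<open>x \<in> S\<close>: the law of \<open>X\<close> under the conditional probability
  \<open>uniform_measure M A\<close>, that is \<open>B \<mapsto> P(A \<inter> B) / P(A)\<close>, restricted to \<open>S\<close>, has density \<open>f\<close>.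
\<close>

definition has_conditional_density_on ::
  "'a measure \<Rightarrow> 'a set \<Rightarrow> ('a \<Rightarrow> real) \<Rightarrow> real set \<Rightarrow> (real \<Rightarrow> real) \<Rightarrow> bool" where
  "has_conditional_density_on M A X S f \<longleftrightarrow>
    A \<in> sets M \<and> measure M A > 0 \<and> X \<in> borel_measurable M \<and>
    f \<in> borel_measurable (restrict_space lborel S) \<and> (\<forall>x\<in>S. 0 \<le> f x) \<and>
    restrict_space (distr (uniform_measure M A) borel X) S =
      density (restrict_space lborel S) (\<lambda>x. ennreal (f x))"

context symmetric_telegraph
begin

lemma path_integrable:
  assumes "\<omega> \<in> space M"
  shows "set_integrable lborel {0..t} (\<lambda>s. V0 \<omega> * (-1) ^ N s \<omega>)"
proof -
  have "mono_on {0..t} (\<lambda>s. real (N s \<omega>))"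
    using count_mono[OF assms] by (auto simp: mono_on_def)
  then have "(\<lambda>s. real (N s \<omega>)) \<in> borel_measurable (restrict_space borel {0..t})"
    by (rule borel_measurable_mono_on_fnc)
  then have "(\<lambda>s. nat \<lfloor>real (N s \<omega>)\<rfloor>) \<in> restrict_space borel {0..t} \<rightarrow>\<^sub>M count_space UNIV"
    by measurable
  then have N: "(\<lambda>s. N s \<omega>) \<in> restrict_space borel {0..t} \<rightarrow>\<^sub>M count_space UNIV"
    by simp
  have "(\<lambda>s. V0 \<omega> * (-1) ^ N s \<omega>) \<in> borel_measurable (restrict_space borel {0..t})"
    by (rule measurable_compose[OF N]) simp
  then have "(\<lambda>s. indicator {0..t} s *\<^sub>R (V0 \<omega> * (-1) ^ N s \<omega>)) \<in> borel_measurable borel"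
    by (simp add: borel_measurable_restrict_space_iff)
  then show ?thesis
    unfolding set_integrable_def
    by (intro integrableI_bounded_set[where A="{0..t}" and B="\<bar>V0 \<omega>\<bar>"])
       (auto simp: abs_mult power_abs indicator_def emeasure_lborel_Icc_eq)
qed

lemma continuous_on_telegraph:
  assumes "\<omega> \<in> space M"
  shows "continuous_on {0..t} (\<lambda>s. telegraph V0 N s \<omega>)"
proof -
  have "telegraph V0 N s \<omega> = integral {0..s} (\<lambda>s. V0 \<omega> * (-1) ^ N s \<omega>)" for s
    unfolding telegraph_def
    by (rule set_borel_integral_eq_integral(2)[OF path_integrable[OF assms]])
  then show ?thesis
    using indefinite_integral_continuous_1[OF
        set_borel_integral_eq_integral(1)[OF path_integrable[OF assms, of t]]]
    by simp
qed

lemma running_max_attained: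
  assumes "\<omega> \<in> space M" "0 \<le> t"
  shows "\<exists>s\<in>{0..t}. running_max (telegraph V0 N) t \<omega> = telegraph V0 N s \<omega> \<and>
           (\<forall>u\<in>{0..t}. telegraph V0 N u \<omega> \<le> telegraph V0 N s \<omega>)"
proof -
  obtain s where s: "s \<in> {0..t}" "\<forall>u\<in>{0..t}. telegraph V0 N u \<omega> \<le> telegraph V0 N s \<omega>"
    using continuous_attains_sup[OF compact_Icc _ continuous_on_telegraph[OF assms(1), of t]]
      assms(2) by auto
  then have "running_max (telegraph V0 N) t \<omega> = telegraph V0 N s \<omega>"
    unfolding running_max_def by (intro cSup_eq_maximum) auto
  with s show ?thesis by blast
qed

end

end

(* The interval [0,t] is cut into m cells. On the event that no cell contains two jumps, the
   velocity read off on the grid is a sign sequence, all sign sequences starting upwards with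
   n = 2k+1 sign changes are equally likely, and the running maximum differs from the maximum of
   the corresponding walk by O(1/m). After the first visit to a level b, reversing the rest of
   the sign sequence and flipping its signs keeps the number of changes - the rest starts upwards
   and, n being odd, ends downwards - and reflects the endpoint of the walk at b. Hence, as in
   the reflection principle, the maximum exceeds b twice as often as the endpoint does, up to
   ties. The endpoint is determined by the number of up-steps, whose distribution is counted by
   products of two binomial coefficients; as m tends to infinity its tail converges to that of a
   Beta(k+1,k+1) law, with density proportional to (c^2 t^2 - x^2)^k. *)

theory Submission
  imports Defs
begin

section \<open>Reflection of sign sequences\<close>

text \<open>Jump times never occur as random variables: only the increments of \<open>N\<close> are
  used, and equally likely grid patterns stand in for jump times that are conditionally uniform. The
  obstacle is that the walk has persistent rather than independent steps, and the number of its
  turns is prescribed. Flipping the rest of the path, as for a simple random walk, in general gains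
  or loses a turn where the flip begins; hence the reversal. A pattern on \<open>m\<close> cells has
  a probability proportional to \<open>1 / m ^ n\<close>, so a count of patterns divided by
  \<open>m ^ n\<close> is the quantity whose limit is taken. Limits of path counts thus carry a
  factor \<open>1 / fact n\<close>, which cancels only in the end, against the probability of the
  conditioning event.\<close>

fun changes :: "bool list \<Rightarrow> nat" where
  "changes (x # y # s) = of_bool (x \<noteq> y) + changes (y # s)"
| "changes _ = 0"

definition height :: "bool list \<Rightarrow> int" where
  "height s = (\<Sum>x\<leftarrow>s. if x then 1 else -1)"

definition reach :: "int \<Rightarrow> bool list \<Rightarrow> bool" where
  "reach b s \<longleftrightarrow> (\<exists>j\<le>length s. b \<le> height (take j s))"

text \<open>
  From the first step up to level \<open>b\<close> onwards (that step included), the sequence is reversed and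
  its signs are flipped.
\<close>

fun reflect :: "int \<Rightarrow> bool list \<Rightarrow> bool list" where
  "reflect b [] = []"
| "reflect b (True # s) = (if b = 1 then map Not (rev (True # s)) else True # reflect (b - 1) s)"
| "reflect b (False # s) = False # reflect (b + 1) s"

lemma height_simps [simp]:
  "height [] = 0" "height (x # s) = (if x then 1 else -1) + height s"
  "height (s @ s') = height s + height s'"
  by (simp_all add: height_def)

lemma height_rev [simp]: "height (rev s) = height s"
  by (induction s) auto

lemma height_map_Not [simp]: "height (map Not s) = - height s"
  by (induction s) auto

lemma changes_Cons: "changes (x # s) = (if s = [] then 0 else of_bool (x \<noteq> hd s) + changes s)"
  by (cases s) auto

lemma changes_snoc:
  "changes (s @ [x]) = (if s = [] then 0 else changes s + of_bool (last s \<noteq> x))"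
  by (induction s) (auto simp: changes_Cons hd_append)

lemma changes_rev [simp]: "changes (rev s) = changes s"
  by (induction s) (auto simp: changes_snoc changes_Cons last_rev)

lemma changes_map_Not [simp]: "changes (map Not s) = changes s"
  by (induction s rule: changes.induct) auto

lemma last_eq_hd_iff: "s \<noteq> [] \<Longrightarrow> last s = hd s \<longleftrightarrow> even (changes s)"
  by (induction s rule: changes.induct) auto

lemma reach_nonpos: "b \<le> 0 \<Longrightarrow> reach b s"
  unfolding reach_def by (intro exI[of _ 0]) auto

lemma reach_Cons:
  assumes "b \<ge> 1"
  shows "reach b (x # s) \<longleftrightarrow> reach (if x then b - 1 else b + 1) s"
proof
  assume "reach b (x # s)"
  then obtain j where j: "j \<le> Suc (length s)" "b \<le> height (take j (x # s))"
    by (auto simp: reach_def)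
  then obtain i where "j = Suc i"
    using assms by (cases j) auto
  with j show "reach (if x then b - 1 else b + 1) s"
    by (auto simp: reach_def intro!: exI[of _ i] split: if_splits)
next
  assume "reach (if x then b - 1 else b + 1) s"
  then obtain i where "i \<le> length s" "(if x then b - 1 else b + 1) \<le> height (take i s)"
    by (auto simp: reach_def)
  then show "reach b (x # s)"
    unfolding reach_def by (intro exI[of _ "Suc i"]) (auto split: if_splits)
qed

lemma reach_Nil [simp]: "reach b [] \<longleftrightarrow> b \<le> 0"
  by (auto simp: reach_def)

lemma reach_height: "b \<le> height s \<Longrightarrow> reach b s"
  unfolding reach_def by (intro exI[of _ "length s"]) auto

lemma length_reflect [simp]: "length (reflect b s) = length s"
  by (induction b s rule: reflect.induct) auto

lemma reflect_eq_Nil [simp]: "reflect b s = [] \<longleftrightarrow> s = []"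
  using length_reflect[of b s] by (metis length_0_conv)

text \<open>A reflected rest begins with the negation of the old last sign. If the sequence ends
  downwards, the rest therefore still begins with a step up, and the junction with the untouched
  prefix contributes the same change as before.\<close>

lemma hd_reflect: "s \<noteq> [] \<Longrightarrow> \<not> last s \<Longrightarrow> hd (reflect b s) = hd s"
  by (induction b s rule: reflect.induct) (auto simp: hd_append hd_rev hd_map last_map)

lemma changes_reflect: "\<not> last s \<Longrightarrow> changes (reflect b s) = changes s"
proof (induction b s rule: reflect.induct)
  case (2 b s)
  show ?case
  proof (cases "b = 1")
    case True
    then show ?thesis
      by (simp del: rev.simps)
  next
    case False
    with 2 show ?thesis
      by (auto simp: changes_Cons hd_reflect split: if_splits)
  qed
qed (auto simp: changes_Cons hd_reflect split: if_splits)

lemma height_reflect: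
  "b \<ge> 1 \<Longrightarrow> reach b s \<Longrightarrow> height (reflect b s) = 2 * (b - 1) - height s"
proof (induction b s rule: reflect.induct)
  case (2 b s)
  then show ?case by (cases "b = 1") (auto simp: reach_Cons)
qed (auto simp: reach_Cons)

text \<open>The prefix is kept and the new rest again begins with a step up, so level
  \<open>b\<close> is first reached at the same position; there, reversing and flipping twice is the
  identity.\<close>

lemma reflect_reflect:
  "b \<ge> 1 \<Longrightarrow> \<not> last s \<Longrightarrow> s \<noteq> [] \<Longrightarrow> reach b s \<Longrightarrow> reflect b (reflect b s) = s \<and> reach b (reflect b s)"
proof (induction b s rule: reflect.induct)
  case (2 b s)
  show ?case
  proof (cases "b = 1")
    case True
    from 2 have "s \<noteq> []" "\<not> last s" by (auto split: if_splits)
    then obtain r where r: "s = r @ [False]" by (cases s rule: rev_cases) auto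
    with True show ?thesis
      by (auto simp: reach_Cons reach_nonpos rev_map o_def)
  next
    case False
    with 2 show ?thesis by (auto simp: reach_Cons split: if_splits)
  qed
qed (auto simp: reach_Cons split: if_splits)

text \<open>There is one sign for each of the \<open>m + 1\<close> grid times, so that the
  \<open>m\<close> adjacent pairs correspond to the cells; \<open>True\<close> stands for the
  initial direction of motion.\<close>

definition paths :: "nat \<Rightarrow> nat \<Rightarrow> bool list set" where
  "paths m n = {s. length s = Suc m \<and> hd s \<and> changes s = n}"

lemma finite_paths [simp]: "finite (paths m n)"
proof -
  have "finite {s :: bool list. set s \<subseteq> UNIV \<and> length s = Suc m}"
    by (rule finite_lists_length_eq) simp
  then show ?thesis
    by (rule rev_finite_subset) (auto simp: paths_def)
qed

lemma last_paths: "s \<in> paths m n \<Longrightarrow> odd n \<Longrightarrow> \<not> last s"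
  using last_eq_hd_iff[of s] by (cases "s = []") (auto simp: paths_def)

text \<open>
  The walk over \<open>m\<close> cells uses only the first \<open>m\<close> of the \<open>m + 1\<close> signs. As the last sign is a down-step
  for odd \<open>n\<close>, its endpoint is \<open>height s + 1\<close>, whence the asymmetry between the two summands.
\<close>

lemma card_reach:
  assumes "b \<ge> 1" "odd n"
  shows "card {s \<in> paths m n. reach b s} =
    card {s \<in> paths m n. b \<le> height s} + card {s \<in> paths m n. b \<le> height s + 1}"
proof -
  let ?R = "\<lambda>Q. {s \<in> paths m n. reach b s \<and> Q (height s)}"
  have inv: "reflect b s \<in> paths m n \<and> reach b (reflect b s) \<and> reflect b (reflect b s) = s \<and>
      height (reflect b s) = 2 * (b - 1) - height s" if "s \<in> paths m n" "reach b s" for s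
  proof -
    have "s \<noteq> []" "\<not> last s"
      using that last_paths[OF that(1) assms(2)] by (auto simp: paths_def)
    with that assms show ?thesis
      using reflect_reflect[of b s] hd_reflect[of s b] changes_reflect[of s b] height_reflect[of b s]
      by (auto simp: paths_def)
  qed
  \<comment> \<open>The map \<open>h\<close> to \<open>2 * (b - 1) - h\<close> exchanges
    \<open>h >= b\<close> with \<open>h <= b - 2\<close>. Its fixed height \<open>b - 1\<close>
    belongs to walks ending exactly at \<open>b\<close>; these are counted in the second summand
    only.\<close>
  have "bij_betw (reflect b) (?R (\<lambda>h. b \<le> h)) (?R (\<lambda>h. h + 1 < b))"
    by (rule bij_betw_byWitness[where f' = "reflect b"]) (auto simp: inv)
  then have eq: "card (?R (\<lambda>h. b \<le> h)) = card (?R (\<lambda>h. h + 1 < b))"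
    by (rule bij_betw_same_card)
  have top: "reach b s" if "s \<in> paths m n" "b \<le> height s + 1" for s
  proof -
    have "s \<noteq> []" "\<not> last s"
      using that last_paths[OF that(1) assms(2)] by (auto simp: paths_def)
    then obtain r where r: "s = r @ [False]" by (cases s rule: rev_cases) auto
    with that have "b \<le> height r" by simp
    then show ?thesis unfolding r reach_def by (intro exI[of _ "length r"]) auto
  qed
  have "{s \<in> paths m n. reach b s} =
    ?R (\<lambda>h. h + 1 < b) \<union> {s \<in> paths m n. b \<le> height s + 1}"
    using top by force
  also have "card \<dots> = card (?R (\<lambda>h. h + 1 < b)) + card {s \<in> paths m n. b \<le> height s + 1}"
    by (rule card_Un_disjoint) auto
  also have "card (?R (\<lambda>h. h + 1 < b)) = card (?R (\<lambda>h. b \<le> h))"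
    using eq by simp
  also have "?R (\<lambda>h. b \<le> h) = {s \<in> paths m n. b \<le> height s}"
    using reach_height by auto
  finally show ?thesis .
qed

section \<open>Counting sign sequences by their up-steps\<close>

text \<open>Ordered sums of \<open>k\<close> positive parts with total \<open>q\<close>. The cases
  \<open>k = 0\<close> and \<open>q = 0\<close> are separate because truncated subtraction would
  give the binomial coefficient a wrong value there, for instance 1 at \<open>q = 0\<close>,
  \<open>k = 1\<close>.\<close>

definition compositions :: "nat \<Rightarrow> nat \<Rightarrow> nat" where
  "compositions q k = (if k = 0 then of_bool (q = 0) else if q = 0 then 0 else (q - 1) choose (k - 1))"

text \<open>The starting sign occurs at least once, whence \<open>Suc p\<close>. The starting sign
  \<open>v\<close> is a parameter because deleting a first run of length one leaves a list starting
  with the opposite sign, in which \<open>p\<close> and \<open>q\<close> exchange roles.\<close>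

definition run_lists :: "bool \<Rightarrow> nat \<Rightarrow> nat \<Rightarrow> nat \<Rightarrow> bool list set" where
  "run_lists v n p q = {s. s \<noteq> [] \<and> hd s = v \<and> changes s = n \<and>
     count_list s v = Suc p \<and> count_list s (\<not> v) = q}"

lemma length_eq_count: "length s = count_list s v + count_list s (\<not> v)" for s :: "bool list"
  by (induction s) auto

lemma finite_run_lists [simp]: "finite (run_lists v n p q)"
proof -
  have "finite {s :: bool list. set s \<subseteq> UNIV \<and> length s = Suc p + q}"
    by (rule finite_lists_length_eq) simp
  then show ?thesis
    by (rule rev_finite_subset) (auto simp: run_lists_def length_eq_count[of _ v])
qed

lemma hd_run_lists: "s \<in> run_lists v n p q \<Longrightarrow> hd s = v"
  by (simp add: run_lists_def)

lemma Nil_notin_run_lists [simp]: "[] \<notin> run_lists v n p q"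
  by (simp add: run_lists_def)

lemma Cons_in_run_lists_iff:
  "x # r \<in> run_lists v n p q \<longleftrightarrow> x = v \<and>
     (r = [] \<and> n = 0 \<and> p = 0 \<and> q = 0 \<or> p \<noteq> 0 \<and> r \<in> run_lists v n (p - 1) q \<or>
      n \<noteq> 0 \<and> q \<noteq> 0 \<and> r \<in> run_lists (\<not> v) (n - 1) (q - 1) p)"
proof (cases r)
  case (Cons y r')
  then show ?thesis
    by (cases x; cases v; cases y) (auto simp: run_lists_def)
qed (auto simp: run_lists_def)

lemma run_lists_Cons:
  "run_lists v n p q = (if n = 0 \<and> p = 0 \<and> q = 0 then {[v]} else {}) \<union>
     Cons v ` ((if p = 0 then {} else run_lists v n (p - 1) q) \<union>
       (if n = 0 \<or> q = 0 then {} else run_lists (\<not> v) (n - 1) (q - 1) p))"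
  (is "_ = ?R")
proof (rule set_eqI)
  fix s
  show "s \<in> run_lists v n p q \<longleftrightarrow> s \<in> ?R"
    by (cases s) (auto simp: Cons_in_run_lists_iff image_iff)
qed

text \<open>A list with \<open>n\<close> changes has \<open>n + 1\<close> alternating runs,
  \<open>n div 2 + 1\<close> of sign \<open>v\<close> and \<open>(n + 1) div 2\<close> of the other
  sign. Their lengths are independent compositions of \<open>Suc p\<close> and of \<open>q\<close>,
  and the former number \<open>p choose (n div 2)\<close>. The induction deletes the first sign
  instead of decomposing into runs; Pascal's rule closes it.\<close>

lemma card_run_lists:
  "card (run_lists v n p q) = (p choose (n div 2)) * compositions q ((n + 1) div 2)"
proof (induction "p + q" arbitrary: v n p q rule: less_induct)
  case less
  let ?A = "if n = 0 \<and> p = 0 \<and> q = 0 then {[v]} else {}"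
  let ?B = "if p = 0 then {} else run_lists v n (p - 1) q"
  let ?C = "if n = 0 \<or> q = 0 then {} else run_lists (\<not> v) (n - 1) (q - 1) p"
  have "card (run_lists v n p q) = card (?A \<union> Cons v ` (?B \<union> ?C))"
    by (subst run_lists_Cons) simp
  also have "\<dots> = card ?A + card (Cons v ` (?B \<union> ?C))"
    by (rule card_Un_disjoint) auto
  also have "card (Cons v ` (?B \<union> ?C)) = card (?B \<union> ?C)"
    by (rule card_image) auto
  also have "\<dots> = card ?B + card ?C"
    by (rule card_Un_disjoint) (auto dest: hd_run_lists split: if_splits)
  also have "card ?B = (if p = 0 then 0 else ((p - 1) choose (n div 2)) * compositions q ((n + 1) div 2))"
    using less[of "p - 1" q v n] by auto
  also have "card ?C = (if n = 0 \<or> q = 0 then 0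
      else ((q - 1) choose ((n - 1) div 2)) * compositions p (n div 2))"
    using less[of "q - 1" p "\<not> v" "n - 1"] by auto
  finally have card: "card (run_lists v n p q) = card ?A +
      ((if p = 0 then 0 else ((p - 1) choose (n div 2)) * compositions q ((n + 1) div 2)) +
       (if n = 0 \<or> q = 0 then 0 else ((q - 1) choose ((n - 1) div 2)) * compositions p (n div 2)))" .
  show ?case
  proof (cases "even n")
    case True
    then obtain k where "n = 2 * k" by (elim evenE)
    with card show ?thesis
      by (cases p; cases q; cases k) (auto simp: compositions_def algebra_simps)
  next
    case False
    then obtain k where "n = 2 * k + 1" by (elim oddE)
    with card show ?thesis
      by (cases p; cases q; cases k) (auto simp: compositions_def algebra_simps)
  qed
qed

lemma card_paths_eq:
  assumes "P \<le> m"
  shows "card {s \<in> paths m (2 * k + 1). count_list s True = Suc P} =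
    (P choose k) * (if P = m then 0 else (m - Suc P) choose k)"
proof -
  have "{s \<in> paths m (2 * k + 1). count_list s True = Suc P} = run_lists True (2 * k + 1) P (m - P)"
    using assms by (auto simp: paths_def run_lists_def length_eq_count[of _ True])
  then show ?thesis
    using assms by (simp add: card_run_lists compositions_def)
qed

text \<open>
  The left side is \<open>\<Sum>P\<in>{a<..m}. ((P - 1) choose k) * ((m - P) choose k)\<close>, the number of
  \<open>(2k+1)\<close>-subsets of \<open>{1..m}\<close> whose median exceeds \<open>a\<close>. Equivalently, at most \<open>k\<close> of the elements
  are \<open>\<le> a\<close>; in this form the number of summands does not grow with \<open>m\<close>.
\<close>

lemma card_paths_gt:
  assumes "a \<le> m"
  shows "card {s \<in> paths m (2 * k + 1). a < count_list s True} =
    (\<Sum>j\<le>k. (a choose j) * ((m - a) choose (2 * k + 1 - j)))"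
  using assms
proof (induction rule: inc_induct)
  case base
  have "count_list s True \<le> m" if "s \<in> paths m (2 * k + 1)" for s
  proof -
    have "s \<noteq> []" "\<not> last s" "length s = Suc m"
      using that last_paths[OF that] by (auto simp: paths_def)
    then obtain r where "s = r @ [False]" by (cases s rule: rev_cases) auto
    with \<open>length s = Suc m\<close> show ?thesis
      using count_le_length[of r True] by simp
  qed
  then have "{s \<in> paths m (2 * k + 1). m < count_list s True} = {}"
    by force
  moreover have "(\<Sum>j\<le>k. (m choose j) * ((m - m) choose (2 * k + 1 - j))) = 0"
    by (intro sum.neutral) (auto intro!: binomial_eq_0)
  ultimately show ?case by (simp only: card.empty)
next
  case (step a)
  let ?n = "2 * k + 1" and ?r = "m - Suc a"
  have "card {s \<in> paths m ?n. a < count_list s True} = card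
      ({s \<in> paths m ?n. count_list s True = Suc a} \<union> {s \<in> paths m ?n. Suc a < count_list s True})"
    by (rule arg_cong[where f = card]) auto
  also have "\<dots> = card {s \<in> paths m ?n. count_list s True = Suc a} +
      card {s \<in> paths m ?n. Suc a < count_list s True}"
    by (rule card_Un_disjoint) auto
  also have "\<dots> = (a choose k) * (?r choose k) +
      (\<Sum>j\<le>k. (Suc a choose j) * (?r choose (?n - j)))"
    using step card_paths_eq[of a m k] by simp
  also have "\<dots> = (\<Sum>j\<le>k. (a choose j) * ((m - a) choose (?n - j)))"
  proof -
    \<comment> \<open>In terms of \<open>?n\<close>-subsets of \<open>{1..m}\<close>: those with at
      most \<open>i\<close> elements \<open><= a\<close> but more than \<open>i\<close> elements
      \<open><= Suc a\<close> contain \<open>Suc a\<close> and exactly \<open>i\<close> smaller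
      elements. The first product counts them; at \<open>i = k\<close> it is the number of paths
      with \<open>Suc a\<close> up-steps.\<close>
    have "(a choose i) * (?r choose (?n - Suc i)) +
        (\<Sum>j\<le>i. (Suc a choose j) * (?r choose (?n - j))) =
        (\<Sum>j\<le>i. (a choose j) * ((m - a) choose (?n - j)))" if "i \<le> k" for i
      using that
    proof (induction i)
      case 0
      have "m - a = Suc ?r" using step by simp
      then show ?case by simp
    next
      case (Suc i)
      have ma: "m - a = Suc ?r" and n: "?n - Suc i = Suc (?n - Suc (Suc i))"
        using step Suc by simp_all
      have "(\<Sum>j\<le>Suc i. (a choose j) * ((m - a) choose (?n - j))) =
        (a choose i) * (?r choose (?n - Suc i)) +
        (\<Sum>j\<le>i. (Suc a choose j) * (?r choose (?n - j))) +
        (a choose Suc i) * ((m - a) choose (?n - Suc i))"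
        using Suc by simp
      moreover have "(m - a) choose (?n - Suc i) =
          (?r choose (?n - Suc (Suc i))) + (?r choose (?n - Suc i))"
        unfolding ma by (subst (1) n, subst binomial_Suc_Suc) (simp only: n)
      ultimately show ?case
        by (simp add: algebra_simps del: diff_Suc_Suc)
    qed
    from this[of k] show ?thesis by (simp add: algebra_simps)
  qed
  finally show ?case .
qed

lemma height_eq_count: "height s = 2 * int (count_list s True) - int (length s)"
  by (induction s) auto

lemma card_paths_reach:
  fixes b m k :: nat
  assumes "1 \<le> b" "b \<le> m"
  shows "card {s \<in> paths m (2 * k + 1). reach (int b) s} =
    (\<Sum>j\<le>k. (((m + b) div 2) choose j) * ((m - (m + b) div 2) choose (2 * k + 1 - j))) +
    (\<Sum>j\<le>k. (((m + b - 1) div 2) choose j) * ((m - (m + b - 1) div 2) choose (2 * k + 1 - j)))"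
proof -
  \<comment> \<open>With \<open>C\<close> up-steps among \<open>m + 1\<close> signs the height is
    \<open>2 * C - (m + 1)\<close>; both conditions take the form \<open>2 * C > r\<close> with
    \<open>r = m + b\<close> or \<open>r = m + b - 1\<close>, that is
    \<open>C > r div 2\<close>.\<close>
  have up: "{s \<in> paths m (2 * k + 1). int b \<le> height s} =
      {s \<in> paths m (2 * k + 1). (m + b) div 2 < count_list s True}"
    by (auto simp: paths_def height_eq_count)
  have up': "{s \<in> paths m (2 * k + 1). int b \<le> height s + 1} =
      {s \<in> paths m (2 * k + 1). (m + b - 1) div 2 < count_list s True}"
    using assms by (auto simp: paths_def height_eq_count)
  have le: "(m + b) div 2 \<le> m" "(m + b - 1) div 2 \<le> m"
    using assms by auto
  have b: "1 \<le> int b" and n: "odd (2 * k + 1)"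
    using assms by simp_all
  show ?thesis
    unfolding card_reach[OF b n] up up' card_paths_gt[OF le(1)] card_paths_gt[OF le(2)] ..
qed

text \<open>A path is determined by the cells in which it turns. Here the count is read off from the
  threshold \<open>a = 0\<close>, which every path passes since it starts upwards.\<close>

lemma card_paths: "card (paths m (2 * k + 1)) = m choose (2 * k + 1)"
proof -
  have "{s \<in> paths m (2 * k + 1). 0 < count_list s True} = paths m (2 * k + 1)"
  proof -
    have "0 < count_list s True" if "s \<in> paths m (2 * k + 1)" for s
      using that by (cases s) (auto simp: paths_def)
    then show ?thesis by auto
  qed
  then have "card (paths m (2 * k + 1)) = (\<Sum>j\<le>k. (0 choose j) * (m choose (2 * k + 1 - j)))"
    using card_paths_gt[of 0 m k] by simp
  also have "\<dots> = (\<Sum>j\<in>{0}. (0 choose j) * (m choose (2 * k + 1 - j)))"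
    by (rule sum.mono_neutral_right) auto
  finally show ?thesis by simp
qed

section \<open>Asymptotics of the path counts\<close>

lemma tendsto_binomial_over_power:
  assumes "(\<lambda>m. real (a m) / real m) \<longlonglongrightarrow> u"
  shows "(\<lambda>m. real (a m choose j) / real m ^ j) \<longlonglongrightarrow> u ^ j / fact j"
proof -
  have "(\<lambda>m. (\<Prod>i<j. real (a m) / real m - real i / real m) / fact j) \<longlonglongrightarrow> (\<Prod>i<j. u - 0) / fact j"
    by (intro tendsto_intros assms lim_const_over_n) simp
  \<comment> \<open>The identity includes \<open>m = 0\<close>: division by zero makes both sides 0
    unless \<open>j = 0\<close>, when both are 1.\<close>
  moreover have "real (a m choose j) / real m ^ j =
      (\<Prod>i<j. real (a m) / real m - real i / real m) / fact j" for m
    by (simp add: binomial_gbinomial gbinomial_prod_rev atLeast0LessThan prod_dividef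
        flip: diff_divide_distrib)
  ultimately show ?thesis by simp
qed

text \<open>For \<open>0 <= u <= 1\<close>, \<open>fact (2 * k + 1)\<close> times this is the
  probability that at most \<open>k\<close> of \<open>2 * k + 1\<close> independent uniform points
  of [0,1] are \<open><= u\<close>, that is, that their median exceeds \<open>u\<close>.\<close>

definition beta_tail :: "nat \<Rightarrow> real \<Rightarrow> real" where
  "beta_tail k u = (\<Sum>j\<le>k. u ^ j / fact j * ((1 - u) ^ (2 * k + 1 - j) / fact (2 * k + 1 - j)))"

lemma tendsto_beta_tail:
  assumes "(\<lambda>m. real (a m) / real m) \<longlonglongrightarrow> u" "\<And>m. a m \<le> m"
  shows "(\<lambda>m. real (\<Sum>j\<le>k. (a m choose j) * ((m - a m) choose (2 * k + 1 - j))) / real m ^ (2 * k + 1))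
    \<longlonglongrightarrow> beta_tail k u"
proof -
  have "(\<lambda>m. 1 - real (a m) / real m) \<longlonglongrightarrow> 1 - u"
    by (intro tendsto_intros assms)
  moreover have "\<forall>\<^sub>F m in sequentially. 1 - real (a m) / real m = real (m - a m) / real m"
    using eventually_gt_at_top[of 0] by eventually_elim (use assms(2) in \<open>simp add: of_nat_diff field_simps\<close>)
  ultimately have "(\<lambda>m. real (m - a m) / real m) \<longlonglongrightarrow> 1 - u"
    by (rule Lim_transform_eventually)
  then have "(\<lambda>m. \<Sum>j\<le>k. real (a m choose j) / real m ^ j *
      (real ((m - a m) choose (2 * k + 1 - j)) / real m ^ (2 * k + 1 - j))) \<longlonglongrightarrow> beta_tail k u"
    unfolding beta_tail_def by (intro tendsto_intros tendsto_binomial_over_power assms)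
  moreover have "(\<Sum>j\<le>k. real (a m choose j) / real m ^ j *
      (real ((m - a m) choose (2 * k + 1 - j)) / real m ^ (2 * k + 1 - j))) =
    real (\<Sum>j\<le>k. (a m choose j) * ((m - a m) choose (2 * k + 1 - j))) / real m ^ (2 * k + 1)" for m
  proof -
    have "real m ^ (2 * k + 1) = real m ^ j * real m ^ (2 * k + 1 - j)" if "j \<le> k" for j
      using that by (simp flip: power_add)
    then show ?thesis
      by (simp add: sum_divide_distrib del: add_2_eq_Suc' power_Suc) 
  qed
  ultimately show ?thesis by simp
qed

lemma continuous_beta_tail: "isCont (beta_tail k) u"
  unfolding beta_tail_def by (intro continuous_intros) auto

lemma beta_tail_1 [simp]: "beta_tail k 1 = 0"
  unfolding beta_tail_def by (intro sum.neutral) auto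

text \<open>By symmetry the median of \<open>2 * k + 1\<close> uniform points exceeds 1/2 with
  probability 1/2; algebraically, the lower half of an odd binomial row has half of its sum. The
  value is needed at level 0, which corresponds to \<open>u = 1 / 2\<close>.\<close>

lemma beta_tail_half: "2 * fact (2 * k + 1) * beta_tail k (1 / 2) = 1"
proof -
  have "fact (2 * k + 1) * beta_tail k (1 / 2) =
      (\<Sum>j\<le>k. real ((2 * k + 1) choose j) / 2 ^ (2 * k + 1))"
    unfolding beta_tail_def sum_distrib_left
  proof (rule sum.cong)
    fix j assume "j \<in> {..k}"
    then have j: "j \<le> 2 * k + 1" by simp
    have "(1 / 2 :: real) ^ (2 * k + 1) = (1 / 2) ^ j * (1 / 2) ^ (2 * k + 1 - j)"
      using j by (subst power_add[symmetric]) simp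
    then show "fact (2 * k + 1) * ((1 / 2) ^ j / fact j * ((1 - 1 / 2) ^ (2 * k + 1 - j) / fact (2 * k + 1 - j))) =
        real ((2 * k + 1) choose j) / 2 ^ (2 * k + 1)"
      using binomial_fact[OF j, where 'a = real] by (simp add: power_one_over field_simps del: fact_Suc power_Suc)
  qed simp
  also have "\<dots> = real (\<Sum>j\<le>k. (2 * k + 1) choose j) / 2 ^ (2 * k + 1)"
    by (simp add: sum_divide_distrib)
  also have "\<dots> = 1 / 2"
    by (subst binomial_r_part_sum) simp
  finally show ?thesis by simp
qed

text \<open>The powers divided by factorials differentiate into one another. In the product rule the
  positive part of each summand cancels the negative part of the preceding one, so only the negative
  part of the last summand, \<open>j = k\<close>, survives.\<close>

lemma has_field_derivative_beta_tail:
  "(beta_tail k has_field_derivative - (u ^ k * (1 - u) ^ k / (fact k)\<^sup>2)) (at u)"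
proof -
  let ?n = "2 * k + 1"
  let ?term = "\<lambda>j u. u ^ j / fact j * ((1 - u) ^ (?n - j) / fact (?n - j)) :: real"
  have up: "((\<lambda>u. u ^ Suc d / fact (Suc d)) has_field_derivative u ^ d / fact d) (at u)" for d
    by (auto intro!: derivative_eq_intros simp del: power_Suc)
  have down: "((\<lambda>u. (1 - u) ^ Suc d / fact (Suc d)) has_field_derivative - ((1 - u) ^ d / fact d)) (at u)" for d
    by (auto intro!: derivative_eq_intros simp del: power_Suc)
  have "((\<lambda>u. \<Sum>j\<le>i. ?term j u) has_field_derivative
      - (u ^ i / fact i * ((1 - u) ^ (?n - Suc i) / fact (?n - Suc i)))) (at u)" if "i \<le> k" for i
    using that
  proof (induction i)
    case 0
    show ?case using down[of "2 * k"] by (simp del: fact_Suc power_Suc)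
  next
    case (Suc i)
    define d where "d = ?n - Suc (Suc i)"
    with Suc.prems have d: "?n - Suc i = Suc d" by linarith
    have termD: "(?term (Suc i) has_field_derivative
        u ^ i / fact i * ((1 - u) ^ Suc d / fact (Suc d)) +
        - ((1 - u) ^ d / fact d) * (u ^ Suc i / fact (Suc i))) (at u)"
      unfolding d by (rule DERIV_mult[OF up down])
    have sumD: "((\<lambda>u. \<Sum>j\<le>i. ?term j u) has_field_derivative
        - (u ^ i / fact i * ((1 - u) ^ Suc d / fact (Suc d)))) (at u)"
      using Suc unfolding d by (simp del: fact_Suc power_Suc)
    have "((\<lambda>u. (\<Sum>j\<le>i. ?term j u) + ?term (Suc i) u) has_field_derivative
        - (u ^ Suc i / fact (Suc i) * ((1 - u) ^ d / fact d))) (at u)"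
      by (rule DERIV_cong[OF DERIV_add[OF sumD termD]]) (simp add: mult.commute del: fact_Suc power_Suc)
    then show ?case
      unfolding sum.atMost_Suc d_def .
  qed
  from this[of k] show ?thesis
    by (simp add: beta_tail_def[abs_def] power2_eq_square)
qed

lemma tendsto_card_paths:
  "(\<lambda>m. real (card (paths m (2 * k + 1))) / real m ^ (2 * k + 1)) \<longlonglongrightarrow> 1 / fact (2 * k + 1)"
proof -
  have "(\<lambda>m. real m / real m) \<longlonglongrightarrow> 1"
    by (rule Lim_transform_eventually[OF tendsto_const])
      (use eventually_gt_at_top[of 0] in eventually_elim, simp)
  from tendsto_binomial_over_power[OF this, of "2 * k + 1"] show ?thesis
    unfolding card_paths by simp
qed

text \<open>A walk ending at height \<open>y * m\<close> takes a proportion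
  \<open>(1 + y) / 2\<close> of its steps upwards. The two thresholds of
  \<open>card_paths_reach\<close> differ by at most one, so the ties disappear in the limit and the
  factor 2 of the reflection remains.\<close>

lemma tendsto_card_paths_reach:
  assumes y: "0 < y" "y < 1"
  shows "(\<lambda>m. real (card {s \<in> paths m (2 * k + 1). reach \<lceil>y * real m\<rceil> s}) / real m ^ (2 * k + 1))
    \<longlonglongrightarrow> 2 * beta_tail k ((1 + y) / 2)"
proof -
  let ?n = "2 * k + 1"
  define b where "b m = nat \<lceil>y * real m\<rceil>" for m
  have b: "y * real m \<le> real (b m)" "real (b m) \<le> y * real m + 1" "int (b m) = \<lceil>y * real m\<rceil>" for m
    using y mult_nonneg_nonneg[of y "real m"] by (auto simp: b_def simp del: mult_nonneg_nonneg)
  have le: "b m \<le> m" for m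
    using y by (simp add: b_def ceiling_le_iff mult_left_le_one_le)
  \<comment> \<open>The choices \<open>e = 0\<close> and \<open>e = 1\<close> give the two
    thresholds. Rounding in \<open>b m\<close> and in \<open>div\<close> costs at most
    \<open>1 / m\<close> after division by \<open>m\<close>.\<close>
  have lim: "(\<lambda>m. real ((m + b m - e) div 2) / real m) \<longlonglongrightarrow> (1 + y) / 2" if "e \<le> 1" for e
  proof (rule tendsto_sandwich)
    show "\<forall>\<^sub>F m in sequentially. (1 + y) / 2 - 1 / real m \<le> real ((m + b m - e) div 2) / real m"
      using eventually_gt_at_top[of 0]
    proof eventually_elim
      case (elim m)
      have "m + b m \<le> 2 * ((m + b m - e) div 2) + 2" using that by linarith
      from of_nat_mono[OF this, where 'a = real]
      have "real m + real (b m) \<le> 2 * real ((m + b m - e) div 2) + 2"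
        by (simp only: of_nat_add of_nat_mult of_nat_numeral)
      with b(1)[of m] have "((1 + y) / 2 * real m - 1) / real m \<le> real ((m + b m - e) div 2) / real m"
        by (intro divide_right_mono) (simp_all add: field_simps)
      with elim show ?case by (simp add: diff_divide_distrib)
    qed
    show "\<forall>\<^sub>F m in sequentially. real ((m + b m - e) div 2) / real m \<le> (1 + y) / 2 + 1 / real m"
      using eventually_gt_at_top[of 0]
    proof eventually_elim
      case (elim m)
      have "2 * ((m + b m - e) div 2) \<le> m + b m" by linarith
      from of_nat_mono[OF this, where 'a = real]
      have "2 * real ((m + b m - e) div 2) \<le> real m + real (b m)"
        by (simp only: of_nat_add of_nat_mult of_nat_numeral)
      with b(2)[of m] have "real ((m + b m - e) div 2) / real m \<le> ((1 + y) / 2 * real m + 1) / real m"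
        by (intro divide_right_mono) (simp_all add: field_simps)
      with elim show ?case by (simp add: add_divide_distrib)
    qed
    show "(\<lambda>m. (1 + y) / 2 - 1 / real m) \<longlonglongrightarrow> (1 + y) / 2"
      using tendsto_diff[OF tendsto_const lim_const_over_n[of 1], of "(1 + y) / 2"] by simp
    show "(\<lambda>m. (1 + y) / 2 + 1 / real m) \<longlonglongrightarrow> (1 + y) / 2"
      using tendsto_add[OF tendsto_const lim_const_over_n[of 1], of "(1 + y) / 2"] by simp
  qed
  have le': "(m + b m - e) div 2 \<le> m" for m e
    using le[of m] by linarith
  have "(\<lambda>m. real (\<Sum>j\<le>k. ((m + b m - 0) div 2 choose j) * ((m - (m + b m - 0) div 2) choose (?n - j))) / real m ^ ?n +
      real (\<Sum>j\<le>k. ((m + b m - 1) div 2 choose j) * ((m - (m + b m - 1) div 2) choose (?n - j))) / real m ^ ?n)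
    \<longlonglongrightarrow> beta_tail k ((1 + y) / 2) + beta_tail k ((1 + y) / 2)" (is "?f \<longlonglongrightarrow> _")
    by (intro tendsto_add tendsto_beta_tail lim le') simp_all
  moreover have "\<forall>\<^sub>F m in sequentially. ?f m =
      real (card {s \<in> paths m ?n. reach \<lceil>y * real m\<rceil> s}) / real m ^ ?n"
    using eventually_gt_at_top[of 0]
  proof eventually_elim
    case (elim m)
    have "0 < y * real m" using elim y by simp
    then have "1 \<le> b m" unfolding b_def by linarith
    from card_paths_reach[OF this le[of m], of k] show ?case
      unfolding b(3) by (simp add: add_divide_distrib)
  qed
  ultimately show ?thesis
    using Lim_transform_eventually by (force simp only: mult_2)
qed

section \<open>Sign sequences read by index\<close>

lemma changes_eq_sum: "changes s = (\<Sum>i<length s - 1. of_bool (s ! i \<noteq> s ! Suc i))"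
proof (induction s rule: changes.induct)
  case (1 x y s)
  then show ?case
    by (simp add: sum.lessThan_Suc_shift del: sum.lessThan_Suc)
qed auto

lemma height_take_Suc:
  "j < length s \<Longrightarrow> height (take (Suc j) s) = height (take j s) + (if s ! j then 1 else -1)"
  by (simp add: take_Suc_conv_app_nth)

lemma nth_0_paths: "s \<in> paths m n \<Longrightarrow> s ! 0"
  by (cases s) (auto simp: paths_def)

lemma sum_changes_paths:
  assumes "s \<in> paths m n"
  shows "(\<Sum>i<m. of_bool (s ! i \<noteq> s ! Suc i)) = n"
proof -
  have "length s - 1 = m" "changes s = n"
    using assms by (simp_all add: paths_def)
  then show ?thesis
    using changes_eq_sum[of s] by (simp only:)
qed

text \<open>Only the first \<open>m\<close> steps correspond to motion during [0,t]. The final sign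
  is a down-step, so a level held after it was already held before it.\<close>

lemma reach_paths:
  assumes "s \<in> paths m n" "odd n" "reach b s" "1 \<le> b"
  shows "\<exists>j\<le>m. b \<le> height (take j s)"
proof -
  obtain j where j: "j \<le> Suc m" "b \<le> height (take j s)"
    using assms by (auto simp: reach_def paths_def)
  show ?thesis
  proof (cases "j = Suc m")
    case True
    have len: "length s = Suc m" and "s \<noteq> []" using assms by (auto simp: paths_def)
    then have "\<not> s ! m"
      using last_paths[OF assms(1,2)] by (simp add: last_conv_nth)
    then have "height (take (Suc m) s) = height (take m s) - 1"
      using height_take_Suc[of m s] len by simp
    with j True show ?thesis by (intro exI[of _ m]) auto
  next
    case False
    with j show ?thesis by (intro exI[of _ j]) auto
  qed
qed

section \<open>Densities from tails\<close>

text \<open>Tails at levels in [a,b) suffice: since \<open>H\<close> tends to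
  \<open>H b = 0\<close>, no mass of \<open>P\<close> lies in [b,\<infinity>), neither an atom at
  \<open>b\<close> nor anything beyond. Mass in (-\<infinity>,a] is left free.\<close>

lemma restrict_space_eq_density_Ioo:
  fixes P :: "real measure" and f H :: "real \<Rightarrow> real"
  assumes "finite_measure P" and P: "sets P = sets borel"
    and "a < b"
    and f: "f \<in> borel_measurable borel" "\<And>x. a \<le> x \<Longrightarrow> x \<le> b \<Longrightarrow> 0 \<le> f x"
    and deriv: "\<And>x. (H has_field_derivative - f x) (at x)" and Hb: "H b = 0"
    and tails: "\<And>x. a \<le> x \<Longrightarrow> x < b \<Longrightarrow> measure P {x<..} = H x"
  shows "restrict_space P {a<..<b} = density (restrict_space lborel {a<..<b}) (\<lambda>x. ennreal (f x))"
proof -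
  interpret finite_measure P by fact
  let ?S = "{a<..<b}"
  have [measurable_cong]: "sets P = sets borel" by (rule P)
  have [measurable]: "f \<in> borel_measurable borel" by (rule f(1))
  have le: "measure P {b..} \<le> H x" if "a \<le> x" "x < b" for x
    unfolding tails[OF that, symmetric] using that by (intro finite_measure_mono) (auto simp: P)
  have "measure P {b..} \<le> H b"
  proof (rule tendsto_lowerbound)
    show "(H \<longlongrightarrow> H b) (at_left b)"
      using DERIV_isCont[OF deriv, of b] by (simp add: isCont_def filterlim_at_split)
    show "\<forall>\<^sub>F x in at_left b. measure P {b..} \<le> H x"
      using eventually_at_left_real[OF \<open>a < b\<close>] by eventually_elim (intro le; simp)
  qed simp
  then have b0: "measure P {b..} = 0"
    using Hb measure_nonneg[of P "{b..}"] by simp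
  have Ioo: "emeasure P {x<..<b} = ennreal (H x)" if "a \<le> x" "x < b" for x
  proof -
    have "measure P {x<..} = measure P ({x<..<b} \<union> {b..})"
      using that by (intro arg_cong[where f = "measure P"]) auto
    also have "\<dots> = measure P {x<..<b} + measure P {b..}"
      by (rule finite_measure_Union) (auto simp: P)
    finally show ?thesis
      using b0 tails[OF that] by (simp add: emeasure_eq_measure)
  qed
  have nn_Ioo: "(\<integral>\<^sup>+y. ennreal (f y) * indicator {x<..<b} y \<partial>lborel) = ennreal (H x)"
    if "a \<le> x" "x < b" for x
  proof -
    have "(\<integral>\<^sup>+y. ennreal (f y) * indicator {x<..<b} y \<partial>lborel) =
        (\<integral>\<^sup>+y. ennreal (f y) * indicator {x..b} y \<partial>lborel)"
    proof (rule nn_integral_cong_AE)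
      show "AE y in lborel. ennreal (f y) * indicator {x<..<b} y = ennreal (f y) * indicator {x..b} y"
        using AE_lborel_singleton[of x] AE_lborel_singleton[of b]
        by eventually_elim (auto simp: indicator_def)
    qed
    also have "\<dots> = ennreal (- H b - - H x)"
    proof (rule nn_integral_FTC_Icc)
      show "((\<lambda>x. - H x) has_real_derivative f y) (at y)" for y
        using DERIV_minus[OF deriv[of y]] by simp
    qed (use f that in auto)
    finally show ?thesis using Hb by simp
  qed
  \<comment> \<open>Both restricted measures are extended by zero to the whole line, where agreement
    on the rays \<open>{x<..}\<close> identifies finite measures.\<close>
  let ?L = "density P (indicator ?S)"
  let ?R = "density lborel (\<lambda>x. ennreal (f x) * indicator ?S x)"
  have L: "emeasure ?L B = emeasure P (?S \<inter> B)" if "B \<in> sets borel" for B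
  proof -
    have "emeasure ?L B = (\<integral>\<^sup>+x. indicator ?S x * indicator B x \<partial>P)"
      using that by (intro emeasure_density) (auto simp: P)
    also have "\<dots> = (\<integral>\<^sup>+x. indicator (?S \<inter> B) x \<partial>P)"
      by (simp only: indicator_inter_arith)
    also have "\<dots> = emeasure P (?S \<inter> B)"
      using that by (intro nn_integral_indicator) (auto simp: P)
    finally show ?thesis .
  qed
  have R: "emeasure ?R B = (\<integral>\<^sup>+x. ennreal (f x) * indicator (?S \<inter> B) x \<partial>lborel)"
    if "B \<in> sets borel" for B
    using that by (subst emeasure_density) (auto simp: indicator_inter_arith mult.assoc)
  have LR: "?L = ?R"
  proof (rule measure_eqI_lessThan)
    fix x :: real
    show "emeasure ?L {x<..} < \<infinity>"
      by (subst L) (auto simp: emeasure_eq_measure)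
    have eq: "?S \<inter> {x<..} = {max a x<..<b}" by auto
    show "emeasure ?L {x<..} = emeasure ?R {x<..}"
    proof (cases "max a x < b")
      case True
      then show ?thesis
        using Ioo[of "max a x"] nn_Ioo[of "max a x"]
        by (subst L, simp, subst R, simp) (simp add: eq)
    next
      case False
      then have "?S \<inter> {x<..} = {}" by auto
      then show ?thesis
        by (subst L, simp, subst R, simp) simp
    qed
  qed (simp_all add: P)
  show ?thesis
  proof (rule measure_eqI)
    show "sets (restrict_space P ?S) = sets (density (restrict_space lborel ?S) (\<lambda>x. ennreal (f x)))"
      by (simp add: sets_restrict_space P)
    fix B assume "B \<in> sets (restrict_space P ?S)"
    then have B: "B \<subseteq> ?S" "B \<in> sets borel" "B \<in> sets (restrict_space lborel ?S)"
      using sets_restrict_space_iff[of ?S P B] sets_restrict_space_iff[of ?S lborel B] by (simp_all add: P)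
    have SB: "?S \<inter> B = B" using B by auto
    have "emeasure (restrict_space P ?S) B = emeasure P B"
      using B by (intro emeasure_restrict_space) (auto simp: P)
    also have "\<dots> = emeasure ?R B"
      using L[OF B(2)] LR SB by simp
    also have "\<dots> = emeasure (density (restrict_space lborel ?S) (\<lambda>x. ennreal (f x))) B"
    proof -
      have "(\<lambda>x. ennreal (f x)) \<in> borel_measurable (restrict_space lborel ?S)"
        by (rule measurable_restrict_space1) simp
      then have "emeasure (density (restrict_space lborel ?S) (\<lambda>x. ennreal (f x))) B =
          (\<integral>\<^sup>+x. ennreal (f x) * indicator B x * indicator ?S x \<partial>lborel)"
        using B(3) by (simp add: emeasure_density nn_integral_restrict_space)
      also have "\<dots> = (\<integral>\<^sup>+x. ennreal (f x) * indicator (?S \<inter> B) x \<partial>lborel)"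
        by (intro nn_integral_cong) (auto simp: indicator_def)
      finally show ?thesis using R[OF B(2)] by simp
    qed
    finally show "emeasure (restrict_space P ?S) B =
      emeasure (density (restrict_space lborel ?S) (\<lambda>x. ennreal (f x))) B" .
  qed
qed

section \<open>The telegraph process on a grid\<close>

context symmetric_telegraph
begin

section \<open>Comparison of the path with a walk\<close>

lemma telegraph_increment:
  assumes "\<omega> \<in> space M" "0 \<le> a" "a \<le> b"
  shows "((\<lambda>s. V0 \<omega> * (-1) ^ N s \<omega>) has_integral telegraph V0 N b \<omega> - telegraph V0 N a \<omega>) {a..b}"
proof -
  let ?f = "\<lambda>s. V0 \<omega> * (-1) ^ N s \<omega>"
  have tel: "telegraph V0 N s \<omega> = integral {0..s} ?f" for s
    unfolding telegraph_def
    by (rule set_borel_integral_eq_integral(2)[OF path_integrable[OF assms(1)]])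
  have int: "?f integrable_on {0..b}"
    by (rule set_borel_integral_eq_integral(1)[OF path_integrable[OF assms(1)]])
  have "integral {0..a} ?f + integral {a..b} ?f = integral {0..b} ?f"
    using assms by (intro Henstock_Kurzweil_Integration.integral_combine int) auto
  moreover have "?f integrable_on {a..b}"
    by (rule integrable_on_subinterval[OF int]) (use assms in auto)
  ultimately show ?thesis
    unfolding tel by (metis add_diff_cancel_left' integrable_integral)
qed

text \<open>The speed is kept as \<open>\<bar>V0 \<omega>\<bar>\<close> because \<open>V0\<close> is
  \<open>c\<close> or \<open>-c\<close> only almost surely, while measurability of the running
  maximum is derived from estimates on every sample path.\<close>

lemma telegraph_lipschitz:
  assumes "\<omega> \<in> space M" "0 \<le> a" "a \<le> b"
  shows "\<bar>telegraph V0 N b \<omega> - telegraph V0 N a \<omega>\<bar> \<le> \<bar>V0 \<omega>\<bar> * (b - a)"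
  using has_integral_bound_real[OF _ finite.emptyI telegraph_increment[OF assms], of "\<bar>V0 \<omega>\<bar>"] assms
  by (simp add: abs_mult power_abs)

text \<open>The error vanishes unless a jump occurs, and then the increment of \<open>N\<close> is
  at least 1. Bounding by this increment rather than by an indicator lets the errors of successive
  cells telescope, whether or not a cell has several jumps.\<close>

lemma telegraph_euler_step:
  assumes "\<omega> \<in> space M" "0 \<le> a" "a \<le> b"
  shows "\<bar>telegraph V0 N b \<omega> - telegraph V0 N a \<omega> - V0 \<omega> * (b - a) * (-1) ^ N a \<omega>\<bar>
    \<le> 2 * \<bar>V0 \<omega>\<bar> * (b - a) * (real (N b \<omega>) - real (N a \<omega>))"
proof -
  have mono: "N a \<omega> \<le> N s \<omega>" "N s \<omega> \<le> N b \<omega>" if "s \<in> {a..b}" for s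
    using count_mono[OF assms(1)] assms that by (auto simp: mono_on_def)
  show ?thesis
  proof (cases "N a \<omega> = N b \<omega>")
    case True
    have "((\<lambda>s. V0 \<omega> * (-1) ^ N s \<omega>) has_integral (b - a) * (V0 \<omega> * (-1) ^ N a \<omega>)) {a..b}"
    proof (rule has_integral_eq)
      show "V0 \<omega> * (-1) ^ N a \<omega> = V0 \<omega> * (-1) ^ N s \<omega>" if "s \<in> {a..b}" for s
        using mono[OF that] True by simp
      show "((\<lambda>s. V0 \<omega> * (-1) ^ N a \<omega>) has_integral (b - a) * (V0 \<omega> * (-1) ^ N a \<omega>)) {a..b}"
        using has_integral_const_real[of "V0 \<omega> * (-1) ^ N a \<omega>" a b] assms by simp
    qed
    from has_integral_unique[OF this telegraph_increment[OF assms]] True show ?thesis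
      by (simp add: algebra_simps)
  next
    case False
    then have "Suc (N a \<omega>) \<le> N b \<omega>"
      using mono[of b] assms by simp
    then have ge: "1 \<le> real (N b \<omega>) - real (N a \<omega>)"
      by linarith
    have "\<bar>telegraph V0 N b \<omega> - telegraph V0 N a \<omega> - V0 \<omega> * (b - a) * (-1) ^ N a \<omega>\<bar>
      \<le> \<bar>telegraph V0 N b \<omega> - telegraph V0 N a \<omega>\<bar> + \<bar>V0 \<omega> * (b - a) * (-1) ^ N a \<omega>\<bar>"
      by (rule abs_triangle_ineq4)
    also have "\<dots> \<le> 2 * \<bar>V0 \<omega>\<bar> * (b - a) * 1"
      using telegraph_lipschitz[OF assms] assms by (simp add: abs_mult power_abs)
    also have "\<dots> \<le> 2 * \<bar>V0 \<omega>\<bar> * (b - a) * (real (N b \<omega>) - real (N a \<omega>))"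
      using ge assms by (intro mult_left_mono) auto
    finally show ?thesis .
  qed
qed

definition walk :: "real \<Rightarrow> nat \<Rightarrow> 'a \<Rightarrow> real" where
  "walk h j \<omega> = (\<Sum>i<j. (-1) ^ N (real i * h) \<omega>)"

lemma telegraph_walk:
  assumes "\<omega> \<in> space M" "0 \<le> h"
  shows "\<bar>telegraph V0 N (real j * h) \<omega> - V0 \<omega> * h * walk h j \<omega>\<bar>
    \<le> 2 * \<bar>V0 \<omega>\<bar> * h * real (N (real j * h) \<omega>)"
proof (induction j)
  case 0
  have "telegraph V0 N 0 \<omega> = 0"
    unfolding telegraph_def set_lebesgue_integral_def
    by (rule integral_eq_zero_AE, rule AE_mp[OF AE_lborel_singleton[of 0]]) (auto simp: indicator_def)
  then show ?case
    using assms by (simp add: walk_def)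
next
  case (Suc j)
  have h: "real (Suc j) * h - real j * h = h"
    by (simp add: algebra_simps)
  have "\<bar>telegraph V0 N (real (Suc j) * h) \<omega> - telegraph V0 N (real j * h) \<omega>
      - V0 \<omega> * h * (-1) ^ N (real j * h) \<omega>\<bar>
    \<le> 2 * \<bar>V0 \<omega>\<bar> * h * (real (N (real (Suc j) * h) \<omega>) - real (N (real j * h) \<omega>))"
    using telegraph_euler_step[OF assms(1), of "real j * h" "real (Suc j) * h"] assms(2)
    unfolding h by (simp add: mult_right_mono)
  moreover have "walk h (Suc j) \<omega> = walk h j \<omega> + (-1) ^ N (real j * h) \<omega>"
    by (simp add: walk_def)
  ultimately show ?case
    using Suc.IH by (simp only: distrib_left right_diff_distrib)
qed

lemma running_max_ge_walk:
  assumes "\<omega> \<in> space M" "0 \<le> h" "real j * h \<le> t"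
  shows "V0 \<omega> * h * walk h j \<omega> - \<bar>V0 \<omega>\<bar> * h * (2 * real (N t \<omega>) + 1)
    \<le> running_max (telegraph V0 N) t \<omega>"
proof -
  have jt: "0 \<le> real j * h"
    using assms by simp
  then have t: "0 \<le> t"
    using assms by linarith
  have "N (real j * h) \<omega> \<le> N t \<omega>"
    using count_mono[OF assms(1)] jt t assms by (auto simp: mono_on_def)
  then have "2 * \<bar>V0 \<omega>\<bar> * h * real (N (real j * h) \<omega>) \<le> 2 * \<bar>V0 \<omega>\<bar> * h * real (N t \<omega>)"
    using assms by (intro mult_left_mono) auto
  moreover have "0 \<le> \<bar>V0 \<omega>\<bar> * h"
    using assms by simp
  moreover have "telegraph V0 N (real j * h) \<omega> \<le> running_max (telegraph V0 N) t \<omega>"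
    using running_max_attained[OF assms(1) t] assms jt by force
  moreover have "\<bar>V0 \<omega>\<bar> * h * (2 * real (N t \<omega>) + 1) = 2 * \<bar>V0 \<omega>\<bar> * h * real (N t \<omega>) + \<bar>V0 \<omega>\<bar> * h"
    by (simp add: algebra_simps)
  ultimately show ?thesis
    using telegraph_walk[OF assms(1,2), of j] by linarith
qed

lemma running_max_le_walk:
  assumes "\<omega> \<in> space M" "0 < h" "t = real m * h"
  obtains j where "j \<le> m" "running_max (telegraph V0 N) t \<omega> \<le>
    V0 \<omega> * h * walk h j \<omega> + \<bar>V0 \<omega>\<bar> * h * (2 * real (N t \<omega>) + 1)"
proof -
  have t: "0 \<le> t" using assms by simp
  obtain s where s: "s \<in> {0..t}" "running_max (telegraph V0 N) t \<omega> = telegraph V0 N s \<omega>"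
    using running_max_attained[OF assms(1) t] by force
  \<comment> \<open>\<open>j * h\<close> is the last grid time not after a maximizing time
    \<open>s\<close>. The Lipschitz bound on the remaining piece, shorter than a cell, accounts for
    the \<open>+ 1\<close> in the error.\<close>
  define j where "j = nat \<lfloor>s / h\<rfloor>"
  have "0 \<le> s / h" using s assms by simp
  then have "real j \<le> s / h" "s / h < real j + 1"
    unfolding j_def by linarith+
  then have j: "real j * h \<le> s" "s - real j * h \<le> h"
    using assms(2) by (simp_all add: pos_le_divide_eq pos_divide_less_eq algebra_simps)
  then have "real j * h \<le> real m * h"
    using s(1) assms(3) unfolding atLeastAtMost_iff by linarith
  then have jm: "j \<le> m"
    using assms(2) by (simp only: mult_le_cancel_right_pos of_nat_le_iff)
  have "N (real j * h) \<omega> \<le> N t \<omega>"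
    using count_mono[OF assms(1)] assms(2) s j t by (auto simp: mono_on_def)
  then have "2 * \<bar>V0 \<omega>\<bar> * h * real (N (real j * h) \<omega>) \<le> 2 * \<bar>V0 \<omega>\<bar> * h * real (N t \<omega>)"
    using assms by (intro mult_left_mono) auto
  moreover have "\<bar>V0 \<omega>\<bar> * (s - real j * h) \<le> \<bar>V0 \<omega>\<bar> * h"
    using j by (intro mult_left_mono) auto
  moreover have "\<bar>V0 \<omega>\<bar> * h * (2 * real (N t \<omega>) + 1) = 2 * \<bar>V0 \<omega>\<bar> * h * real (N t \<omega>) + \<bar>V0 \<omega>\<bar> * h"
    by (simp add: algebra_simps)
  moreover have "0 \<le> real j * h" using assms by simp
  ultimately have "running_max (telegraph V0 N) t \<omega> \<le>
      V0 \<omega> * h * walk h j \<omega> + \<bar>V0 \<omega>\<bar> * h * (2 * real (N t \<omega>) + 1)"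
    using telegraph_walk[OF assms(1), of h j] telegraph_lipschitz[OF assms(1) _ j(1)] assms(2) s(2)
    by linarith
  with jm show ?thesis by (rule that)
qed

lemma walk_measurable:
  assumes "0 \<le> h"
  shows "walk h j \<in> borel_measurable M"
proof -
  have "(\<lambda>\<omega>. (-1) ^ N (real i * h) \<omega> :: real) \<in> borel_measurable M" for i
    by (rule measurable_compose[OF count_measurable]) (use assms in auto)
  then show ?thesis
    unfolding walk_def by measurable
qed

text \<open>The supremum runs over uncountably many times, so it is exhibited as a pointwise limit
  of maxima of finitely many measurable walk positions; for each \<open>\<omega>\<close> the error
  is of order \<open>1 / m\<close>.\<close>

lemma running_max_measurable:
  assumes "0 < t"
  shows "running_max (telegraph V0 N) t \<in> borel_measurable M"
proof (rule borel_measurable_LIMSEQ_real)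
  let ?h = "\<lambda>m. t / real m"
  let ?X = "\<lambda>m \<omega>. Max ((\<lambda>j. V0 \<omega> * ?h m * walk (?h m) j \<omega>) ` {..m})"
  show "?X m \<in> borel_measurable M" for m
    using assms V0_measurable walk_measurable[of "?h m"]
    by (intro borel_measurable_Max borel_measurable_times) auto
  fix \<omega> assume \<omega>: "\<omega> \<in> space M"
  have "\<forall>\<^sub>F m in sequentially. norm (?X m \<omega> - running_max (telegraph V0 N) t \<omega>) \<le>
      \<bar>V0 \<omega>\<bar> * t * (2 * real (N t \<omega>) + 1) / real m"
    using eventually_gt_at_top[of 0]
  proof eventually_elim
    case (elim m)
    let ?f = "\<lambda>j. V0 \<omega> * ?h m * walk (?h m) j \<omega>"
    have "?X m \<omega> \<in> ?f ` {..m}"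
      by (rule Max_in) auto
    then obtain i where i: "?X m \<omega> = ?f i" "i \<in> {..m}" by (rule imageE)
    obtain j where j: "j \<le> m" "running_max (telegraph V0 N) t \<omega> \<le>
        ?f j + \<bar>V0 \<omega>\<bar> * ?h m * (2 * real (N t \<omega>) + 1)"
      using running_max_le_walk[OF \<omega>, of "?h m" t m] assms elim by auto
    have "?f j \<le> ?X m \<omega>"
      using j by (intro Max_ge) auto
    moreover have "real i * ?h m \<le> t"
      using i(2) assms elim by (simp add: field_simps)
    ultimately show ?case
      using j(2) running_max_ge_walk[OF \<omega>, of "?h m" i t] i(1) assms by (simp add: abs_le_iff)
  qed
  then have "(\<lambda>m. ?X m \<omega> - running_max (telegraph V0 N) t \<omega>) \<longlonglongrightarrow> 0"
    by (rule Lim_null_comparison) (rule lim_const_over_n)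
  then show "(\<lambda>m. ?X m \<omega>) \<longlonglongrightarrow> running_max (telegraph V0 N) t \<omega>"
    by (rule LIM_zero_cancel)
qed

section \<open>Grid events and their probabilities\<close>

text \<open>Prescribing increments rather than signs excludes two jumps in a cell and makes the
  event an intersection of independent ones. Only changes of \<open>s\<close> enter, so its first
  sign must be fixed separately, as \<open>paths\<close> does.\<close>

definition grid_event :: "real \<Rightarrow> nat \<Rightarrow> bool list \<Rightarrow> 'a set" where
  "grid_event h m s = {\<omega> \<in> space M. \<forall>i<m.
     N (real (Suc i) * h) \<omega> - N (real i * h) \<omega> = of_bool (s ! i \<noteq> s ! Suc i)}"

lemma count_grid_event:
  assumes "\<omega> \<in> grid_event h m s" "0 \<le> h" "j \<le> m"
  shows "N (real j * h) \<omega> = (\<Sum>i<j. of_bool (s ! i \<noteq> s ! Suc i))"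
  using assms(3)
proof (induction j)
  case 0
  then show ?case
    using assms(1) count_zero by (simp add: grid_event_def)
next
  case (Suc j)
  have \<omega>: "\<omega> \<in> space M"
    using assms by (simp add: grid_event_def)
  have "N (real j * h) \<omega> \<le> N (real (Suc j) * h) \<omega>"
    using count_mono[OF \<omega>] assms(2) by (auto simp: mono_on_def mult_right_mono)
  moreover have "N (real (Suc j) * h) \<omega> - N (real j * h) \<omega> = of_bool (s ! j \<noteq> s ! Suc j)"
    using assms(1) Suc.prems by (auto simp: grid_event_def)
  ultimately have "N (real (Suc j) * h) \<omega> = N (real j * h) \<omega> + of_bool (s ! j \<noteq> s ! Suc j)"
    by linarith
  with Suc show ?case
    by (simp only: sum.lessThan_Suc)
qed

lemma sign_grid_event:
  assumes "\<omega> \<in> grid_event h m s" "0 \<le> h" "s ! 0" "j \<le> m"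
  shows "even (N (real j * h) \<omega>) \<longleftrightarrow> s ! j"
  unfolding count_grid_event[OF assms(1,2,4)] using assms(3)
  by (induction j) (auto split: if_splits)

lemma walk_grid_event:
  assumes "\<omega> \<in> grid_event h m s" "0 \<le> h" "s \<in> paths m n" "j \<le> m"
  shows "walk h j \<omega> = real_of_int (height (take j s))"
  using assms(4)
proof (induction j)
  case 0
  then show ?case by (simp add: walk_def)
next
  case (Suc j)
  have s: "s ! 0" "length s = Suc m"
    using assms(3) nth_0_paths by (auto simp: paths_def)
  have "walk h (Suc j) \<omega> = walk h j \<omega> + (-1) ^ N (real j * h) \<omega>"
    by (simp add: walk_def)
  also have "(-1) ^ N (real j * h) \<omega> = (if s ! j then 1 else -1 :: real)"
    using sign_grid_event[OF assms(1,2) s(1), of j] Suc.prems by (auto simp: minus_one_power_iff)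
  finally show ?case
    using Suc s by (simp add: height_take_Suc)
qed

lemma total_grid_event:
  assumes "\<omega> \<in> grid_event h m s" "0 \<le> h" "s \<in> paths m n"
  shows "N (real m * h) \<omega> = n"
  using count_grid_event[OF assms(1,2) order_refl] sum_changes_paths[OF assms(3)] by (simp only:)

lemma disjoint_grid_events:
  assumes "0 \<le> h"
  shows "disjoint_family_on (grid_event h m) (paths m n)"
  unfolding disjoint_family_on_def
proof (intro ballI impI equals0I)
  fix s s' \<omega>
  assume *: "s \<in> paths m n" "s' \<in> paths m n" "s \<noteq> s'" "\<omega> \<in> grid_event h m s \<inter> grid_event h m s'"
  then have len: "length s = Suc m" "length s' = Suc m" "s ! 0" "s' ! 0"
    using nth_0_paths by (auto simp: paths_def)
  have "s = s'"
  proof (rule nth_equalityI)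
    show "s ! j = s' ! j" if "j < length s" for j
      using sign_grid_event[of \<omega> h m s j] sign_grid_event[of \<omega> h m s' j] * that assms len by auto
  qed (use len in simp)
  with * show False by simp
qed

lemma prob_increment:
  assumes "0 \<le> a" "a < b"
  shows "prob {\<omega> \<in> space M. N b \<omega> - N a \<omega> = n} =
    (rate * (b - a)) ^ n / fact n * exp (- (rate * (b - a)))"
proof -
  have meas: "(\<lambda>\<omega>. N b \<omega> - N a \<omega>) \<in> measurable M (count_space UNIV)"
    using count_measurable[of a] measurable_compose[OF count_measurable[of b], of "\<lambda>k. k - n" "count_space UNIV" for n] assms
    by (intro measurable_compose_countable[of "\<lambda>n \<omega>. N b \<omega> - n" M _ "N a"]) simp_all
  have "prob {\<omega> \<in> space M. N b \<omega> - N a \<omega> = n} =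
      measure (distr M (count_space UNIV) (\<lambda>\<omega>. N b \<omega> - N a \<omega>)) {n}"
    by (subst measure_distr[OF meas]) (auto intro!: arg_cong[where f = prob])
  also have "\<dots> = pmf (poisson_pmf (rate * (b - a))) n"
    unfolding poisson_increments[OF assms] by (simp add: measure_pmf_single)
  also have "\<dots> = (rate * (b - a)) ^ n / fact n * exp (- (rate * (b - a)))"
    using rate_pos assms by simp
  finally show ?thesis .
qed

text \<open>Every cell contributes \<open>exp (- (rate * h))\<close>, and each of the
  \<open>n\<close> cells with a jump a further \<open>rate * h\<close>. The value depends on
  \<open>s\<close> only through \<open>n\<close>: this is the equal likelihood of all paths.\<close>

lemma prob_grid_event:
  assumes "0 < h" "0 < m" "s \<in> paths m n"
  shows "prob (grid_event h m s) = exp (- (rate * (real m * h))) * (rate * h) ^ n"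
proof -
  let ?X = "\<lambda>i \<omega>. N (real (Suc i) * h) \<omega> - N (real i * h) \<omega>"
  let ?x = "\<lambda>i. of_bool (s ! i \<noteq> s ! Suc i) :: nat"
  have lt: "real i * h < real (Suc i) * h" for i
    using assms by simp
  have "indep_vars (\<lambda>_. count_space UNIV) ?X {..<m}"
    using independent_increments[of "\<lambda>i. real i * h" m] lt by simp
  from indep_varsD[OF this, of "{..<m}" "\<lambda>i. {?x i}"] assms
  have "prob (\<Inter>i\<in>{..<m}. ?X i -` {?x i} \<inter> space M) = (\<Prod>i<m. prob (?X i -` {?x i} \<inter> space M))"
    by auto
  also have "(\<Inter>i\<in>{..<m}. ?X i -` {?x i} \<inter> space M) = grid_event h m s"
    using assms(2) by (auto simp: grid_event_def)
  also have "(\<Prod>i<m. prob (?X i -` {?x i} \<inter> space M)) = (\<Prod>i<m. (rate * h) ^ ?x i * exp (- (rate * h)))"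
  proof (rule prod.cong)
    fix i
    have h: "real (Suc i) * h - real i * h = h"
      by (simp add: algebra_simps)
    have "?X i -` {?x i} \<inter> space M = {\<omega> \<in> space M. ?X i \<omega> = ?x i}"
      by auto
    moreover have "fact (?x i) = (1 :: real)"
      by simp
    ultimately show "prob (?X i -` {?x i} \<inter> space M) = (rate * h) ^ ?x i * exp (- (rate * h))"
      using prob_increment[OF _ lt[of i], of "?x i"] assms(1) unfolding h by simp
  qed simp
  also have "\<dots> = (rate * h) ^ (\<Sum>i<m. ?x i) * exp (- (rate * h)) ^ m"
    by (simp only: prod.distrib power_sum prod_constant card_lessThan)
  also have "(\<Sum>i<m. ?x i) = n"
    by (rule sum_changes_paths[OF assms(3)])
  also have "exp (- (rate * h)) ^ m = exp (- (rate * (real m * h)))"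
    by (simp add: exp_of_nat_mult[symmetric] algebra_simps)
  finally show ?thesis
    by (simp add: mult.commute)
qed

text \<open>A finite product of discrete spaces on \<open>nat\<close> is again discrete, so an
  arbitrary predicate of finitely many counts defines an event, and independence of
  \<open>V0\<close> from the whole process specialises to it.\<close>

lemma prob_V0_count:
  assumes "finite T" "T \<subseteq> {0..}"
  shows "{\<omega> \<in> space M. P (\<lambda>\<tau>\<in>T. N \<tau> \<omega>)} \<in> events"
    and "prob {\<omega> \<in> space M. V0 \<omega> = c \<and> P (\<lambda>\<tau>\<in>T. N \<tau> \<omega>)} =
      1 / 2 * prob {\<omega> \<in> space M. P (\<lambda>\<tau>\<in>T. N \<tau> \<omega>)}"
proof -
  let ?S = "\<Pi>\<^sub>M \<tau>\<in>{0..}. count_space (UNIV :: nat set)"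
  let ?Z = "\<lambda>\<omega>. \<lambda>\<tau>\<in>{0..}. N \<tau> \<omega>"
  let ?B = "{f \<in> space ?S. P (restrict f T)}"
  have PiM_T: "(\<Pi>\<^sub>M \<tau>\<in>T. count_space (UNIV :: nat set)) = count_space (T \<rightarrow>\<^sub>E UNIV)"
    using assms(1) by (intro count_space_PiM_finite) auto
  have "{g \<in> space (\<Pi>\<^sub>M \<tau>\<in>T. count_space (UNIV :: nat set)). P g} \<in> sets (\<Pi>\<^sub>M \<tau>\<in>T. count_space UNIV)"
    unfolding PiM_T by auto
  from measurable_sets[OF measurable_restrict_subset[OF assms(2)] this]
  have B: "?B \<in> sets ?S"
    by (rule back_subst[of "\<lambda>A. A \<in> sets ?S"]) (auto simp: space_PiM)
  have Z: "?Z \<in> space M \<rightarrow> space ?S"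
    by (auto simp: space_PiM)
  have eq: "?Z -` ?B \<inter> space M = {\<omega> \<in> space M. P (\<lambda>\<tau>\<in>T. N \<tau> \<omega>)}"
  proof -
    have "restrict (?Z \<omega>) T = (\<lambda>\<tau>\<in>T. N \<tau> \<omega>)" for \<omega>
      using assms(2) by (auto simp: restrict_def fun_eq_iff)
    then show ?thesis using Z by auto
  qed
  have ev2: "{\<omega> \<in> space M. P (\<lambda>\<tau>\<in>T. N \<tau> \<omega>)} \<in> sets (vimage_algebra (space M) ?Z ?S)"
    unfolding eq[symmetric] by (rule in_vimage_algebra[OF B])
  have ev1: "{\<omega> \<in> space M. V0 \<omega> = c} \<in> sets (vimage_algebra (space M) V0 borel)"
    using in_vimage_algebra[of "{c}" borel V0 "space M"] by (simp add: vimage_def Collect_conj_eq Int_commute)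
  show "{\<omega> \<in> space M. P (\<lambda>\<tau>\<in>T. N \<tau> \<omega>)} \<in> events"
    using indep_setD_ev2[OF V0_indep] ev2 by blast
  have "prob ({\<omega> \<in> space M. V0 \<omega> = c} \<inter> {\<omega> \<in> space M. P (\<lambda>\<tau>\<in>T. N \<tau> \<omega>)}) =
      1 / 2 * prob {\<omega> \<in> space M. P (\<lambda>\<tau>\<in>T. N \<tau> \<omega>)}"
    using indep_setD[OF V0_indep ev1 ev2] V0_pos by simp
  moreover have "{\<omega> \<in> space M. V0 \<omega> = c} \<inter> {\<omega> \<in> space M. P (\<lambda>\<tau>\<in>T. N \<tau> \<omega>)} =
      {\<omega> \<in> space M. V0 \<omega> = c \<and> P (\<lambda>\<tau>\<in>T. N \<tau> \<omega>)}"
    by auto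
  ultimately show "prob {\<omega> \<in> space M. V0 \<omega> = c \<and> P (\<lambda>\<tau>\<in>T. N \<tau> \<omega>)} =
      1 / 2 * prob {\<omega> \<in> space M. P (\<lambda>\<tau>\<in>T. N \<tau> \<omega>)}"
    by simp
qed

lemma prob_V0_grid_event:
  assumes "0 < h" "0 < m" "s \<in> paths m n"
  shows "{\<omega> \<in> grid_event h m s. V0 \<omega> = c} \<in> events"
    and "prob {\<omega> \<in> grid_event h m s. V0 \<omega> = c} = 1 / 2 * (exp (- (rate * (real m * h))) * (rate * h) ^ n)"
proof -
  let ?T = "(\<lambda>i. real i * h) ` {..m}"
  let ?P = "\<lambda>f. \<forall>i<m. f (real (Suc i) * h) - f (real i * h) = of_bool (s ! i \<noteq> s ! Suc i)"
  have T: "finite ?T" "?T \<subseteq> {0..}"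
    using assms by auto
  have P: "?P (\<lambda>\<tau>\<in>?T. N \<tau> \<omega>) \<longleftrightarrow> ?P (\<lambda>\<tau>. N \<tau> \<omega>)" for \<omega>
  proof -
    have N: "(\<lambda>\<tau>\<in>?T. N \<tau> \<omega>) (real i * h) = N (real i * h) \<omega>" if "i \<le> m" for i
      by (rule restrict_apply', rule imageI) (use that in simp)
    show ?thesis
    proof (intro all_cong1 imp_cong refl)
      fix i assume "i < m"
      then show "(\<lambda>\<tau>\<in>?T. N \<tau> \<omega>) (real (Suc i) * h) - (\<lambda>\<tau>\<in>?T. N \<tau> \<omega>) (real i * h) =
          of_bool (s ! i \<noteq> s ! Suc i) \<longleftrightarrow>
        N (real (Suc i) * h) \<omega> - N (real i * h) \<omega> = of_bool (s ! i \<noteq> s ! Suc i)"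
        by (simp only: N[OF less_imp_le] N[OF Suc_leI])
    qed
  qed
  have ev: "grid_event h m s \<in> events"
    using prob_V0_count(1)[OF T, of ?P] unfolding P grid_event_def .
  have "{\<omega> \<in> space M. V0 \<omega> = c} \<in> events"
    using V0_measurable by simp
  then have "grid_event h m s \<inter> {\<omega> \<in> space M. V0 \<omega> = c} \<in> events"
    using ev by auto
  moreover have "grid_event h m s \<inter> {\<omega> \<in> space M. V0 \<omega> = c} = {\<omega> \<in> grid_event h m s. V0 \<omega> = c}"
    by (auto simp: grid_event_def)
  ultimately show "{\<omega> \<in> grid_event h m s. V0 \<omega> = c} \<in> events"
    by simp
  have "{\<omega> \<in> grid_event h m s. V0 \<omega> = c} = {\<omega> \<in> space M. V0 \<omega> = c \<and> ?P (\<lambda>\<tau>. N \<tau> \<omega>)}"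
    by (auto simp: grid_event_def)
  then show "prob {\<omega> \<in> grid_event h m s. V0 \<omega> = c} = 1 / 2 * (exp (- (rate * (real m * h))) * (rate * h) ^ n)"
    using prob_V0_count(2)[OF T, of ?P] prob_grid_event[OF assms] unfolding P grid_event_def by simp
qed

lemma prob_V0_total:
  assumes "0 < t"
  shows "{\<omega> \<in> space M. V0 \<omega> = c \<and> N t \<omega> = n} \<in> events"
    and "prob {\<omega> \<in> space M. V0 \<omega> = c \<and> N t \<omega> = n} = 1 / 2 * ((rate * t) ^ n / fact n * exp (- (rate * t)))"
proof -
  have T: "finite {t}" "{t} \<subseteq> {0..}" using assms by auto
  have "{\<omega> \<in> space M. V0 \<omega> = c} \<inter> {\<omega> \<in> space M. N t \<omega> = n} \<in> events"
    using V0_measurable prob_V0_count(1)[OF T, of "\<lambda>f. f t = n"] by (intro sets.Int) simp_all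
  then show "{\<omega> \<in> space M. V0 \<omega> = c \<and> N t \<omega> = n} \<in> events"
    by (rule back_subst[of "\<lambda>A. A \<in> events"]) auto
  have "{\<omega> \<in> space M. N t \<omega> = n} = {\<omega> \<in> space M. N t \<omega> - N 0 \<omega> = n}"
    using count_zero by auto
  then show "prob {\<omega> \<in> space M. V0 \<omega> = c \<and> N t \<omega> = n} = 1 / 2 * ((rate * t) ^ n / fact n * exp (- (rate * t)))"
    using prob_V0_count(2)[OF T, of "\<lambda>f. f t = n"] prob_increment[of 0 t n] assms by simp
qed

lemma prob_paths:
  assumes "0 < h" "0 < m" "Q \<subseteq> paths m n"
  shows "(\<Union>s\<in>Q. {\<omega> \<in> grid_event h m s. V0 \<omega> = c}) \<in> events"
    and "prob (\<Union>s\<in>Q. {\<omega> \<in> grid_event h m s. V0 \<omega> = c}) =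
      real (card Q) * (1 / 2 * (exp (- (rate * (real m * h))) * (rate * h) ^ n))"
proof -
  have Q: "finite Q" by (rule finite_subset[OF assms(3)]) simp
  show "(\<Union>s\<in>Q. {\<omega> \<in> grid_event h m s. V0 \<omega> = c}) \<in> events"
    using Q assms prob_V0_grid_event(1)[OF assms(1,2)] by (intro sets.finite_UN) auto
  have "disjoint_family_on (\<lambda>s. {\<omega> \<in> grid_event h m s. V0 \<omega> = c}) Q"
    unfolding disjoint_family_on_def
  proof (intro ballI impI)
    fix s s' assume "s \<in> Q" "s' \<in> Q" "s \<noteq> s'"
    then have "grid_event h m s \<inter> grid_event h m s' = {}"
      using disjoint_grid_events[of h m n] assms by (auto simp: disjoint_family_on_def subset_iff)
    then show "{\<omega> \<in> grid_event h m s. V0 \<omega> = c} \<inter> {\<omega> \<in> grid_event h m s'. V0 \<omega> = c} = {}"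
      by blast
  qed
  then have "prob (\<Union>s\<in>Q. {\<omega> \<in> grid_event h m s. V0 \<omega> = c}) =
      (\<Sum>s\<in>Q. prob {\<omega> \<in> grid_event h m s. V0 \<omega> = c})"
    using Q assms prob_V0_grid_event(1)[OF assms(1,2)] by (intro finite_measure_finite_Union) auto
  also have "\<dots> = (\<Sum>s\<in>Q. 1 / 2 * (exp (- (rate * (real m * h))) * (rate * h) ^ n))"
    using assms(3) prob_V0_grid_event(2)[OF assms(1,2)] by (intro sum.cong) auto
  finally show "prob (\<Union>s\<in>Q. {\<omega> \<in> grid_event h m s. V0 \<omega> = c}) =
      real (card Q) * (1 / 2 * (exp (- (rate * (real m * h))) * (rate * h) ^ n))"
    by simp
qed

section \<open>Tail of the running maximum\<close>

definition exceedance :: "real \<Rightarrow> nat \<Rightarrow> real \<Rightarrow> 'a set" where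
  "exceedance t n x = {\<omega> \<in> space M. V0 \<omega> = c \<and> N t \<omega> = n \<and> x < running_max (telegraph V0 N) t \<omega>}"

lemma exceedance_eq:
  "exceedance t n x = {\<omega> \<in> space M. V0 \<omega> = c \<and> N t \<omega> = n} \<inter>
    {\<omega> \<in> space M. x < running_max (telegraph V0 N) t \<omega>}"
  by (auto simp: exceedance_def)

lemma exceedance_events: "0 < t \<Longrightarrow> exceedance t n x \<in> events"
  unfolding exceedance_eq using prob_V0_total(1)[of t n] running_max_measurable[of t]
  by (intro sets.Int) simp_all

text \<open>With \<open>h = t / m\<close>, a path together with \<open>V0 = c\<close> has
  probability \<open>half_weight t n / m ^ n\<close>; the 1/2 is the probability of
  \<open>V0 = c\<close>. Division by \<open>fact n\<close> instead gives the probability of the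
  conditioning event.\<close>

definition half_weight :: "real \<Rightarrow> nat \<Rightarrow> real" where
  "half_weight t n = 1 / 2 * (exp (- (rate * t)) * (rate * t) ^ n)"

lemma prob_V0_total_weight:
  "0 < t \<Longrightarrow> prob {\<omega> \<in> space M. V0 \<omega> = c \<and> N t \<omega> = n} = half_weight t n / fact n"
  by (simp add: prob_V0_total half_weight_def)

lemma half_weight_pos: "0 < t \<Longrightarrow> 0 < half_weight t n"
  using rate_pos by (simp add: half_weight_def)

lemma prob_paths_weight:
  assumes "0 < t" "0 < m" "Q \<subseteq> paths m n"
  shows "prob (\<Union>s\<in>Q. {\<omega> \<in> grid_event (t / real m) m s. V0 \<omega> = c}) =
    half_weight t n * (real (card Q) / real m ^ n)"
  using prob_paths(2)[OF _ assms(2,3), of "t / real m"] assms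
  by (simp add: half_weight_def power_divide)

lemma grid_error_small:
  assumes "0 < t" "0 < d"
  shows "\<forall>\<^sub>F m in sequentially. 0 < m \<and> c * (t / real m) * (2 * real n + 1) < d"
proof -
  have "(\<lambda>m. c * t * (2 * real n + 1) / real m) \<longlonglongrightarrow> 0"
    by (rule lim_const_over_n)
  then have "\<forall>\<^sub>F m in sequentially. c * t * (2 * real n + 1) / real m < d"
    using assms(2) by (rule order_tendstoD)
  then show ?thesis
    using eventually_gt_at_top[of 0] by eventually_elim simp
qed

text \<open>Given \<open>V0 = c\<close> and \<open>N t = n\<close>, the discretisation error is at
  most \<open>c * h * (2 * n + 1)\<close>, uniformly in \<open>\<omega>\<close>. Once this is below
  \<open>z - x\<close>, reaching level \<open>z\<close> on the grid forces the maximum above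
  \<open>x\<close>.\<close>

lemma prob_exceedance_ge:
  assumes "0 < t" "0 \<le> x" "x < z" "z < c * t"
  shows "half_weight t (2 * k + 1) * (2 * beta_tail k ((1 + z / (c * t)) / 2)) \<le> prob (exceedance t (2 * k + 1) x)"
proof (rule tendsto_upperbound)
  let ?n = "2 * k + 1"
  \<comment> \<open>One step of the walk covers the distance \<open>c * t / m\<close>, so level
    \<open>z\<close> lies \<open>y * m\<close> steps up.\<close>
  define y where "y = z / (c * t)"
  have gap: "0 < z - x" using assms by simp
  have ct: "0 < c * t" using assms speed_pos by simp
  then have y: "0 < y" "y < 1" and yct: "y * (c * t) = z"
    using assms speed_pos by (simp_all add: y_def)
  show "(\<lambda>m. half_weight t ?n * (real (card {s \<in> paths m ?n. reach \<lceil>y * real m\<rceil> s}) / real m ^ ?n))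
      \<longlonglongrightarrow> half_weight t ?n * (2 * beta_tail k ((1 + z / (c * t)) / 2))"
    unfolding y_def[symmetric] by (intro tendsto_mult_left tendsto_card_paths_reach y)
  show "\<forall>\<^sub>F m in sequentially. half_weight t ?n *
      (real (card {s \<in> paths m ?n. reach \<lceil>y * real m\<rceil> s}) / real m ^ ?n) \<le> prob (exceedance t ?n x)"
    using grid_error_small[OF assms(1) gap, of ?n]
  proof eventually_elim
    case (elim m)
    let ?Q = "{s \<in> paths m ?n. reach \<lceil>y * real m\<rceil> s}"
    define h where "h = t / real m"
    from elim have m: "0 < m" and small: "c * h * (2 * real ?n + 1) < z - x"
      by (simp_all add: h_def)
    have h: "0 < h" "real m * h = t" using assms m by (simp_all add: h_def)
    have "(\<Union>s\<in>?Q. {\<omega> \<in> grid_event h m s. V0 \<omega> = c}) \<subseteq> exceedance t ?n x"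
    proof
      fix \<omega> assume "\<omega> \<in> (\<Union>s\<in>?Q. {\<omega> \<in> grid_event h m s. V0 \<omega> = c})"
      then obtain s where s: "s \<in> paths m ?n" "reach \<lceil>y * real m\<rceil> s"
        and \<omega>: "\<omega> \<in> grid_event h m s" "V0 \<omega> = c"
        by auto
      have sp: "\<omega> \<in> space M" using \<omega> by (simp add: grid_event_def)
      have "1 \<le> \<lceil>y * real m\<rceil>" using y m by (simp add: one_le_ceiling)
      then obtain j where j: "j \<le> m" "\<lceil>y * real m\<rceil> \<le> height (take j s)"
        using reach_paths[OF s(1) _ s(2)] by auto
      have walk: "walk h j \<omega> = real_of_int (height (take j s))"
        using walk_grid_event[OF \<omega>(1) _ s(1) j(1)] h by simp
      with j(2) have "y * real m \<le> walk h j \<omega>"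
        by (simp add: ceiling_le_iff)
      then have "c * h * (y * real m) \<le> c * h * walk h j \<omega>"
        using h speed_pos by (intro mult_left_mono) auto
      moreover have "c * h * (y * real m) = z"
        using yct unfolding h(2)[symmetric] by (simp add: ac_simps)
      moreover have Nt: "N t \<omega> = ?n"
        using total_grid_event[OF \<omega>(1) _ s(1)] h by simp
      moreover have "real j * h \<le> t"
        using h j by (simp add: h(2)[symmetric])
      ultimately have "x < running_max (telegraph V0 N) t \<omega>"
        using running_max_ge_walk[OF sp, of h j t] h(1) small \<omega>(2) speed_pos by simp
      with sp \<omega>(2) Nt show "\<omega> \<in> exceedance t ?n x"
        by (simp add: exceedance_def)
    qed
    then have "prob (\<Union>s\<in>?Q. {\<omega> \<in> grid_event h m s. V0 \<omega> = c}) \<le> prob (exceedance t ?n x)"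
      using exceedance_events[OF assms(1)] by (intro finite_measure_mono)
    then show ?case
      using prob_paths_weight[OF assms(1) m, of ?Q ?n] by (simp add: h_def)
  qed
qed simp

text \<open>
  Bounding the complement from below by grid events makes it unnecessary to estimate the
  probability that some cell contains two jumps.
\<close>

lemma prob_exceedance_le:
  assumes "0 < t" "0 < z" "z < x" "z < c * t"
  shows "prob (exceedance t (2 * k + 1) x) \<le> half_weight t (2 * k + 1) * (2 * beta_tail k ((1 + z / (c * t)) / 2))"
proof -
  let ?n = "2 * k + 1"
  let ?A = "{\<omega> \<in> space M. V0 \<omega> = c \<and> N t \<omega> = ?n}"
  define y where "y = z / (c * t)"
  have gap: "0 < x - z" using assms by simp
  have ct: "0 < c * t" using assms speed_pos by simp
  then have y: "0 < y" "y < 1" and yct: "y * (c * t) = z"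
    using assms speed_pos by (simp_all add: y_def)
  let ?Q = "\<lambda>m. {s \<in> paths m ?n. \<not> reach \<lceil>y * real m\<rceil> s}"
  have "half_weight t ?n * (1 / fact ?n - 2 * beta_tail k ((1 + y) / 2)) \<le> prob (?A - exceedance t ?n x)"
  proof (rule tendsto_upperbound)
    have card: "real (card (?Q m)) = real (card (paths m ?n)) -
        real (card {s \<in> paths m ?n. reach \<lceil>y * real m\<rceil> s})" for m
    proof -
      have "?Q m = paths m ?n - {s \<in> paths m ?n. reach \<lceil>y * real m\<rceil> s}" by auto
      then show ?thesis
        by (simp add: card_Diff_subset of_nat_diff card_mono)
    qed
    show "(\<lambda>m. half_weight t ?n * (real (card (?Q m)) / real m ^ ?n))
        \<longlonglongrightarrow> half_weight t ?n * (1 / fact ?n - 2 * beta_tail k ((1 + y) / 2))"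
      unfolding card diff_divide_distrib
      by (intro tendsto_mult_left tendsto_diff tendsto_card_paths tendsto_card_paths_reach y)
    show "\<forall>\<^sub>F m in sequentially. half_weight t ?n * (real (card (?Q m)) / real m ^ ?n)
        \<le> prob (?A - exceedance t ?n x)"
      using grid_error_small[OF assms(1) gap, of ?n]
    proof eventually_elim
      case (elim m)
      define h where "h = t / real m"
      from elim have m: "0 < m" and small: "c * h * (2 * real ?n + 1) < x - z"
        by (simp_all add: h_def)
      have h: "0 < h" "real m * h = t" using assms m by (simp_all add: h_def)
      have "(\<Union>s\<in>?Q m. {\<omega> \<in> grid_event h m s. V0 \<omega> = c}) \<subseteq> ?A - exceedance t ?n x"
      proof
        fix \<omega> assume "\<omega> \<in> (\<Union>s\<in>?Q m. {\<omega> \<in> grid_event h m s. V0 \<omega> = c})"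
        then obtain s where s: "s \<in> paths m ?n" "\<not> reach \<lceil>y * real m\<rceil> s"
          and \<omega>: "\<omega> \<in> grid_event h m s" "V0 \<omega> = c"
          by auto
        have sp: "\<omega> \<in> space M" using \<omega> by (simp add: grid_event_def)
        have Nt: "N t \<omega> = ?n"
          using total_grid_event[OF \<omega>(1) _ s(1)] h by simp
        obtain j where j: "j \<le> m" "running_max (telegraph V0 N) t \<omega> \<le>
            V0 \<omega> * h * walk h j \<omega> + \<bar>V0 \<omega>\<bar> * h * (2 * real (N t \<omega>) + 1)"
          using running_max_le_walk[OF sp h(1) h(2)[symmetric]] by blast
        have walk: "walk h j \<omega> = real_of_int (height (take j s))"
          using walk_grid_event[OF \<omega>(1) _ s(1) j(1)] h by simp
        have len: "length s = Suc m"
          using s(1) by (simp add: paths_def)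
        have "height (take j s) < \<lceil>y * real m\<rceil>"
          using s(2) len j(1) by (metis not_le reach_def le_SucI)
        then have "walk h j \<omega> \<le> y * real m"
          unfolding walk by (simp add: less_ceiling_iff)
        then have "c * h * walk h j \<omega> \<le> c * h * (y * real m)"
          using h speed_pos by (intro mult_left_mono) auto
        moreover have "c * h * (y * real m) = z"
          using yct unfolding h(2)[symmetric] by (simp add: ac_simps)
        ultimately have "\<not> x < running_max (telegraph V0 N) t \<omega>"
          using j(2) small \<omega>(2) speed_pos Nt by simp
        with sp \<omega>(2) Nt show "\<omega> \<in> ?A - exceedance t ?n x"
          by (simp add: exceedance_def)
      qed
      then have "prob (\<Union>s\<in>?Q m. {\<omega> \<in> grid_event h m s. V0 \<omega> = c}) \<le> prob (?A - exceedance t ?n x)"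
        using exceedance_events[OF assms(1)] prob_V0_total(1)[OF assms(1)]
        by (intro finite_measure_mono sets.Diff)
      then show ?case
        using prob_paths_weight[OF assms(1) m, of "?Q m" ?n] by (simp add: h_def)
    qed
  qed simp
  moreover have "prob (?A - exceedance t ?n x) = prob ?A - prob (exceedance t ?n x)"
    using exceedance_events[OF assms(1)] prob_V0_total(1)[OF assms(1)]
    by (intro finite_measure_Diff) (auto simp: exceedance_def)
  \<comment> \<open>The grid paths altogether have limiting mass
    \<open>half_weight t ?n / fact ?n\<close>, exactly \<open>prob ?A\<close>, so nothing is lost by
    passing to the complement.\<close>
  ultimately show ?thesis
    using prob_V0_total_weight[OF assms(1), of ?n] unfolding y_def
    by (simp add: right_diff_distrib)
qed

text \<open>The two bounds hold at levels \<open>z\<close> strictly above and strictly below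
  \<open>x\<close>; continuity of \<open>beta_tail\<close> lets \<open>z\<close> tend to
  \<open>x\<close> from either side.\<close>

lemma prob_exceedance:
  assumes "0 < t" "0 \<le> x" "x < c * t"
  shows "prob (exceedance t (2 * k + 1) x) = half_weight t (2 * k + 1) * (2 * beta_tail k ((1 + x / (c * t)) / 2))"
proof (rule antisym)
  let ?n = "2 * k + 1"
  let ?G = "\<lambda>z. half_weight t ?n * (2 * beta_tail k ((1 + z / (c * t)) / 2))"
  have "isCont ?G x"
    using assms speed_pos by (intro continuous_intros isCont_o2[OF _ continuous_beta_tail]) auto
  then have lim: "(?G \<longlongrightarrow> ?G x) (at_left x)" "(?G \<longlongrightarrow> ?G x) (at_right x)"
    by (simp_all add: isCont_def filterlim_at_split)
  show "?G x \<le> prob (exceedance t ?n x)"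
  proof (rule tendsto_upperbound[OF lim(2)])
    show "\<forall>\<^sub>F z in at_right x. ?G z \<le> prob (exceedance t ?n x)"
      using eventually_at_right_real[OF assms(3)]
      by eventually_elim (intro prob_exceedance_ge assms; simp)
  qed simp
  show "prob (exceedance t ?n x) \<le> ?G x"
  proof (cases "x = 0")
    \<comment> \<open>No \<open>z\<close> with \<open>0 < z < x\<close> is available at level 0. The
      trivial bound by the probability of the conditioning event is already sharp, by
      \<open>beta_tail_half\<close>.\<close>
    case True
    have "prob (exceedance t ?n x) \<le> half_weight t ?n / fact ?n"
      unfolding prob_V0_total_weight[OF assms(1), symmetric]
      using prob_V0_total(1)[OF assms(1)] by (intro finite_measure_mono) (auto simp: exceedance_def)
    also have "\<dots> = ?G x"
      using beta_tail_half[of k] True by (simp add: field_simps del: fact_Suc)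
    finally show ?thesis .
  next
    case False
    then have "0 < x" using assms by simp
    show ?thesis
    proof (rule tendsto_lowerbound[OF lim(1)])
      show "\<forall>\<^sub>F z in at_left x. prob (exceedance t ?n x) \<le> ?G z"
        using eventually_at_left_real[OF \<open>0 < x\<close>]
        by eventually_elim (intro prob_exceedance_le assms; use assms in simp)
    qed simp
  qed
qed

end

theorem theorem3p1:
  fixes M :: "'a measure" and rate c t :: real and V0 :: "'a \<Rightarrow> real"
    and N :: "real \<Rightarrow> 'a \<Rightarrow> nat" and k :: nat
  assumes "symmetric_telegraph M rate N c V0"
    and "t > 0"
  shows "has_conditional_density_on M {\<omega> \<in> space M. V0 \<omega> = c \<and> N t \<omega> = 2 * k + 1}
           (running_max (telegraph V0 N) t) {0<..<c * t}
           (\<lambda>\<beta>. 2 * (fact (2 * k + 1) / (fact k)\<^sup>2) *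
                 ((c\<^sup>2 * t\<^sup>2 - \<beta>\<^sup>2) ^ k / (2 * c * t) ^ (2 * k + 1)))"
    (is "has_conditional_density_on M ?A ?X ?S ?f")
proof -
  interpret symmetric_telegraph M rate N c V0 by fact
  have t_pos: "0 < t" by fact
  let ?n = "2 * k + 1"
  let ?U = "uniform_measure M ?A"
  \<comment> \<open>The conditional tail of the maximum: the 2 comes from the reflection, and
    \<open>fact ?n\<close> from dividing by \<open>prob ?A\<close>, where \<open>half_weight\<close>
    cancels.\<close>
  let ?H = "\<lambda>x. 2 * fact ?n * beta_tail k ((1 + x / (c * t)) / 2)"
  have ct: "0 < c * t" using t_pos speed_pos by simp
  have A: "?A \<in> events" and pA: "prob ?A = half_weight t ?n / fact ?n"
    using prob_V0_total(1)[OF t_pos] prob_V0_total_weight[OF t_pos] by simp_all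
  have pos: "0 < prob ?A"
    unfolding pA by (intro divide_pos_pos half_weight_pos t_pos fact_gt_zero)
  then have A0: "emeasure M ?A \<noteq> 0" "emeasure M ?A \<noteq> \<infinity>"
    by (auto simp: emeasure_eq_measure)
  have X: "?X \<in> borel_measurable M"
    by (rule running_max_measurable[OF t_pos])
  have f: "?f \<in> borel_measurable borel"
    by measurable
  have nonneg: "0 \<le> ?f x" if "0 \<le> x" "x \<le> c * t" for x
  proof -
    have "x\<^sup>2 \<le> (c * t)\<^sup>2" using that by (intro power_mono)
    then have "0 \<le> c\<^sup>2 * t\<^sup>2 - x\<^sup>2"
      by (simp add: power_mult_distrib)
    then show ?thesis
      using t_pos speed_pos by (intro mult_nonneg_nonneg divide_nonneg_nonneg zero_le_power) simp_all
  qed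
  have XU: "?X \<in> measurable ?U borel"
    using X by simp
  have "restrict_space (distr ?U borel ?X) ?S = density (restrict_space lborel ?S) (\<lambda>x. ennreal (?f x))"
  proof (rule restrict_space_eq_density_Ioo[where H = ?H])
    interpret U: prob_space ?U
      by (rule prob_space_uniform_measure[OF A0])
    show "finite_measure (distr ?U borel ?X)"
      using U.prob_space_distr[OF XU] by (rule prob_space.finite_measure)
    show "?H (c * t) = 0"
      using t_pos speed_pos by simp
    show "(?H has_field_derivative - ?f x) (at x)" for x
    proof -
      define u where "u = (1 + x / (c * t)) / 2"
      have "((\<lambda>x. (1 + x / (c * t)) / 2) has_field_derivative 1 / (2 * c * t)) (at x)"
        using ct by (auto intro!: derivative_eq_intros)
      from DERIV_cmult[OF DERIV_chain2[OF has_field_derivative_beta_tail this], of "2 * fact ?n" k]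
      have "(?H has_field_derivative
          2 * fact ?n * (- (u ^ k * (1 - u) ^ k / (fact k)\<^sup>2) * (1 / (2 * c * t)))) (at x)"
        unfolding u_def .
      moreover have u: "u = (c * t + x) / (2 * c * t)" "1 - u = (c * t - x) / (2 * c * t)"
        using t_pos speed_pos by (simp_all add: u_def field_simps)
      \<comment> \<open>The two factors combine into a difference of squares; their
        \<open>k\<close>-th power gives \<open>(2 * c * t) ^ (2 * k)\<close>, and the inner
        derivative \<open>1 / (2 * c * t)\<close> supplies the missing factor.\<close>
      have "u * (1 - u) = (c\<^sup>2 * t\<^sup>2 - x\<^sup>2) / (2 * c * t)\<^sup>2"
        unfolding u(2) unfolding u(1) times_divide_times_eq by (simp add: power2_eq_square algebra_simps)
      then have "u ^ k * (1 - u) ^ k = (c\<^sup>2 * t\<^sup>2 - x\<^sup>2) ^ k / (2 * c * t) ^ (2 * k)"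
        by (simp only: power_mult_distrib[symmetric] power_divide power_mult)
      ultimately show ?thesis
        by (simp add: mult_ac del: fact_Suc)
    qed
    show "measure (distr ?U borel ?X) {x<..} = ?H x" if "0 \<le> x" "x < c * t" for x
    proof -
      have "measure (distr ?U borel ?X) {x<..} = measure ?U (?X -` {x<..} \<inter> space ?U)"
        by (rule measure_distr[OF XU]) simp
      also have "?X -` {x<..} \<inter> space ?U = {\<omega> \<in> space M. x < ?X \<omega>}"
        by auto
      also have "measure ?U {\<omega> \<in> space M. x < ?X \<omega>} = prob (exceedance t ?n x) / prob ?A"
        unfolding exceedance_eq using X by (intro measure_uniform_measure A0) simp
      also have "\<dots> = ?H x"
        unfolding prob_exceedance[OF t_pos that] pA
        using half_weight_pos[OF t_pos, of ?n] by (simp del: fact_Suc)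
      finally show ?thesis .
    qed
  qed (use ct f nonneg in auto)
  then show ?thesis
    unfolding has_conditional_density_on_def
    using A pos X f nonneg by (auto intro!: measurable_restrict_space1 less_imp_le)
qed

end
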